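(* Let $\alpha\in[0,1)$. If $G$ is a connected graph of order $n$ with clique number $\omega\ge 2$, then \[ \rho_\alpha(G)\ge\rho_\alpha(PK_{n-\omega,\omega}), \] with equality if and only if $G$ is isomorphic to $PK_{n-\omega,\omega}$.
   Context: Graphs are finite, simple and undirected. For a graph $G$ with adjacency matrix $A(G)$ and diagonal matrix of vertex degrees $D(G)$, and for $\alpha\in[0,1]$, let $A_\alpha(G)=\alpha D(G)+(1-\alpha)A(G)$, and let $\rho_\alpha(G)$ denote the spectral radius (largest eigenvalue) of $A_\alpha(G)$. $PK_{p,q}$ is the graph of order $p+q$ obtained from the disjoint union of the path $P_p$ (of order $p$) and the complete graph $K_q$ by joining, with an edge, an end-vertex of $P_p$ to a vertex of $K_q$; by convention $PK_{0,q}=K_q$. *)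

theory Defs
  imports "Graph_Theory.Graph_Theory" "Jordan_Normal_Form.Spectral_Radius"
begin

text \<open>
  A finite simple undirected graph is a \<^locale>\<open>pair_graph\<close>: a finite, loop-free digraph whose
  arcs form a symmetric set of ordered pairs. Each undirected edge thus contributes two arcs, and
  the degree of a vertex is its out-degree.
\<close>

definition is_clique :: "'a pair_pre_digraph \<Rightarrow> 'a set \<Rightarrow> bool" where
  "is_clique G S \<longleftrightarrow> S \<subseteq> pverts G \<and> (\<forall>u\<in>S. \<forall>v\<in>S. u \<noteq> v \<longrightarrow> (u, v) \<in> parcs G)"

definition clique_number :: "'a pair_pre_digraph \<Rightarrow> nat" where
  "clique_number G = Max (card ` {S. is_clique G S})"

text \<open>
  Matrices are indexed by natural numbers, so the matrices of a graph are taken with respect to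
  an enumeration \<open>vs\<close> of its vertices. The lemma \<open>rho_enumeration\<close> below shows that the
  spectral radius does not depend on it.
\<close>

definition adjacency_mat :: "'a pair_pre_digraph \<Rightarrow> 'a list \<Rightarrow> real mat" where
  "adjacency_mat G vs = mat (length vs) (length vs)
     (\<lambda>(i, j). if (vs ! i, vs ! j) \<in> parcs G then 1 else 0)"

definition degree_mat :: "'a pair_pre_digraph \<Rightarrow> 'a list \<Rightarrow> real mat" where
  "degree_mat G vs = mat (length vs) (length vs)
     (\<lambda>(i, j). if i = j then real (out_degree G (vs ! i)) else 0)"

definition A_alpha :: "real \<Rightarrow> 'a pair_pre_digraph \<Rightarrow> 'a list \<Rightarrow> real mat" where
  "A_alpha \<alpha> G vs = \<alpha> \<cdot>\<^sub>m degree_mat G vs + (1 - \<alpha>) \<cdot>\<^sub>m adjacency_mat G vs"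

definition vertex_list :: "'a pair_pre_digraph \<Rightarrow> 'a list" where
  "vertex_list G = (SOME vs. distinct vs \<and> set vs = pverts G)"

definition rho :: "real \<Rightarrow> 'a pair_pre_digraph \<Rightarrow> real" where
  "rho \<alpha> G = spectral_radius (map_mat complex_of_real (A_alpha \<alpha> G (vertex_list G)))"

text \<open>
  In \<open>PK p q\<close> (for \<open>q \<ge> 1\<close>) the path runs through \<open>0, \<dots>, p - 1\<close>, the complete graph has the
  vertices \<open>p, \<dots>, p + q - 1\<close>, and for \<open>p > 0\<close> the joining edge is between \<open>p - 1\<close> and \<open>p\<close>.
\<close>

definition PK :: "nat \<Rightarrow> nat \<Rightarrow> nat pair_pre_digraph" where
  "PK p q = \<lparr> pverts = {0..<p} \<union> {p..<p + q},
     parcs = {(i, j). i < p \<and> j < p \<and> (j = Suc i \<or> i = Suc j)}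
       \<union> {(i, j). i \<in> {p..<p + q} \<and> j \<in> {p..<p + q} \<and> i \<noteq> j}
       \<union> (if p = 0 then {} else {(p - 1, p), (p, p - 1)}) \<rparr>"

lemma pair_graph_PK:
  assumes "q \<ge> 1"
  shows "pair_graph (PK p q)"
proof unfold_locales
  show "finite (parcs (PK p q))"
    by (rule finite_subset[of _ "{0..<p + q} \<times> {0..<p + q}"])
       (use assms in \<open>auto simp: PK_def split: if_splits\<close>)
  show "symmetric (PK p q)"
    by (auto simp: PK_def symmetric_def sym_def)
qed (use assms in \<open>auto simp: PK_def split: if_splits\<close>)

lemma spectrum_A_alpha:
  assumes "distinct vs"
  shows "spectrum (map_mat complex_of_real (A_alpha \<alpha> G vs)) =
    {k. \<exists>x. (\<exists>v\<in>set vs. x v \<noteq> 0) \<and>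
      (\<forall>v\<in>set vs. (\<Sum>u\<in>set vs.
          complex_of_real ((if u = v then \<alpha> * real (out_degree G v) else 0)
            + (if (v, u) \<in> parcs G then 1 - \<alpha> else 0)) * x u) = k * x v)}"
    (is "?L = {k. \<exists>x. ?P k x}")
proof -
  let ?n = "length vs"
  let ?A = "map_mat complex_of_real (A_alpha \<alpha> G vs)"
  let ?m = "\<lambda>v u. complex_of_real ((if u = v then \<alpha> * real (out_degree G v) else 0)
            + (if (v, u) \<in> parcs G then 1 - \<alpha> else 0))"
  have dim: "?A \<in> carrier_mat ?n ?n"
    by (auto simp: A_alpha_def degree_mat_def adjacency_mat_def)
  have entry: "?A $$ (i, j) = ?m (vs ! i) (vs ! j)" if "i < ?n" "j < ?n" for i j
    using that assms by (auto simp: A_alpha_def degree_mat_def adjacency_mat_def nth_eq_iff_index_eq)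
  have mult: "(?A *\<^sub>v vec ?n (\<lambda>i. x (vs ! i))) $ i = (\<Sum>u\<in>set vs. ?m (vs ! i) u * x u)"
    if "i < ?n" for x i
  proof -
    have "(?A *\<^sub>v vec ?n (\<lambda>i. x (vs ! i))) $ i = (\<Sum>j<?n. ?A $$ (i, j) * x (vs ! j))"
      using that dim by (auto simp: scalar_prod_def lessThan_atLeast0 intro!: sum.cong)
    also have "\<dots> = (\<Sum>j<?n. ?m (vs ! i) (vs ! j) * x (vs ! j))"
      by (intro sum.cong refl) (use entry that in simp)
    also have "\<dots> = (\<Sum>u\<in>set vs. ?m (vs ! i) u * x u)"
      by (rule sum.reindex_bij_betw) (rule bij_betw_nth[OF assms refl refl])
    finally show ?thesis .
  qed
  have P: "?P k x \<longleftrightarrow> eigenvector ?A (vec ?n (\<lambda>i. x (vs ! i))) k" for k x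
  proof -
    have "vec ?n (\<lambda>i. x (vs ! i)) \<noteq> 0\<^sub>v ?n \<longleftrightarrow> (\<exists>v\<in>set vs. x v \<noteq> 0)"
      unfolding vec_eq_iff set_conv_nth by auto
    moreover have "?A *\<^sub>v vec ?n (\<lambda>i. x (vs ! i)) = k \<cdot>\<^sub>v vec ?n (\<lambda>i. x (vs ! i)) \<longleftrightarrow>
        (\<forall>i<?n. (?A *\<^sub>v vec ?n (\<lambda>i. x (vs ! i))) $ i = k * x (vs ! i))"
      using dim by (subst vec_eq_iff) (simp del: index_mult_mat_vec)
    ultimately show ?thesis
      using dim unfolding eigenvector_def all_set_conv_all_nth
      by (simp add: mult[of _ x] del: index_mult_mat_vec)
  qed
  have "eigenvalue ?A k \<longleftrightarrow> (\<exists>x. ?P k x)" for k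
  proof
    assume "eigenvalue ?A k"
    then obtain w where w: "eigenvector ?A w k" by (auto simp: eigenvalue_def)
    then have "dim_vec w = ?n" using dim by (auto simp: eigenvector_def)
    define x where "x = (\<lambda>v. w $ the_inv_into {..<?n} ((!) vs) v)"
    have "vec ?n (\<lambda>i. x (vs ! i)) = w"
      using \<open>dim_vec w = ?n\<close> assms
      by (auto simp: vec_eq_iff x_def the_inv_into_f_f inj_on_nth)
    then have "?P k x" unfolding P using w by simp
    then show "\<exists>x. ?P k x" by (rule exI[of "?P k"])
  next
    assume "\<exists>x. ?P k x"
    then obtain x where "?P k x" by (rule exE)
    then have "eigenvector ?A (vec ?n (\<lambda>i. x (vs ! i))) k" unfolding P .
    then show "eigenvalue ?A k" unfolding eigenvalue_def ..
  qed
  then show ?thesis unfolding spectrum_def by (rule Collect_cong)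
qed

lemma rho_enumeration:
  assumes "distinct vs" "set vs = pverts G"
  shows "rho \<alpha> G = spectral_radius (map_mat complex_of_real (A_alpha \<alpha> G vs))"
proof -
  have "distinct (vertex_list G) \<and> set (vertex_list G) = pverts G"
    unfolding vertex_list_def by (rule someI[of _ vs]) (use assms in simp)
  then show ?thesis
    using assms by (simp add: rho_def spectral_radius_def spectrum_A_alpha)
qed

end

theory Submission
  imports Defs "HOL-Analysis.Function_Topology"
begin

text \<open>
  Let \<open>l = rho \<alpha> (PK P q)\<close> and suppose that \<open>rho \<alpha> G \<le> l\<close>. A Perron vector \<open>x\<close> of \<open>G\<close> then satisfies
  \<open>A_alpha x \<le> l x\<close>. For a vertex \<open>v\<close> of a part hanging off \<open>w\<close>, the quantity
  \<open>\<alpha> + (1 - \<alpha>) x v / x w\<close> is bounded from below by induction along the part. For a path of order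
  \<open>n\<close>, the bound is \<open>h n\<close> with \<open>h 0 = 0\<close> and \<open>h (n + 1) = \<alpha> + (1 - \<alpha>)\<^sup>2 / (l - \<alpha> - h n)\<close>. Since \<open>h\<close>
  is strictly subadditive, a branched part weighs more than a path of the same order. Summing
  the inequalities at the vertices of a maximum clique gives
  \<open>(\<Sum>i. (1 - \<alpha>) / (L - h (p i))) \<le> 1\<close>, where \<open>L = l - \<alpha> q + 1\<close> and the clique vertices carry parts of
  orders \<open>p i\<close>. The Perron vector of \<open>PK P q\<close> yields equality if one \<open>p i\<close> is \<open>P\<close> and the others are 0,
  and \<open>n \<mapsto> h n / (L - h n)\<close> is again strictly subadditive if \<open>q \<ge> 3\<close>. Hence all inequalities are tight,
  and \<open>G\<close> is isomorphic to \<open>PK P q\<close>.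
\<close>

section \<open>Path weights\<close>

text \<open>For fixed \<open>b\<close> both sides solve the recurrence in \<open>a\<close>, so
  \<open>a = 0\<close> and \<open>a = 1\<close> suffice. For \<open>a = 1\<close> the left side is
  the Casoratian, which each step in \<open>b\<close> multiplies by \<open>q\<close>.\<close>

lemma linear_recurrence_casoratian:
  fixes X Y :: "nat \<Rightarrow> real"
  assumes X: "\<And>n. X (n + 2) = t * X (n + 1) - q * X n"
    and Y: "\<And>n. Y (n + 2) = t * Y (n + 1) - q * Y n"
  shows "X (a + b) * Y b - X b * Y (a + b) = q ^ b * (X a * Y 0 - X 0 * Y a)"
proof (induction a rule: induct_nat_012)
  case 1
  show ?case
  proof (induction b)
    case (Suc b)
    have "X (Suc 0 + Suc b) * Y (Suc b) - X (Suc b) * Y (Suc 0 + Suc b) =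
        q * (X (Suc 0 + b) * Y b - X b * Y (Suc 0 + b))"
    proof -
      have eqs: "X (Suc 0 + Suc b) = t * X (Suc b) - q * X b"
        "Y (Suc 0 + Suc b) = t * Y (Suc b) - q * Y b"
        using X[of b] Y[of b] by simp_all
      show ?thesis unfolding eqs by (simp add: algebra_simps)
    qed
    then show ?case
      unfolding Suc by simp
  qed simp
next
  case (ge2 n)
  have eqs: "X (Suc (Suc n) + b) = t * X (Suc n + b) - q * X (n + b)"
    "Y (Suc (Suc n) + b) = t * Y (Suc n + b) - q * Y (n + b)"
    using X[of "n + b"] Y[of "n + b"] by simp_all
  have "X (Suc (Suc n) + b) * Y b - X b * Y (Suc (Suc n) + b) =
      t * (X (Suc n + b) * Y b - X b * Y (Suc n + b)) - q * (X (n + b) * Y b - X b * Y (n + b))"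
    unfolding eqs by (simp add: algebra_simps)
  also have "\<dots> = q ^ b * ((t * X (Suc n) - q * X n) * Y 0 - X 0 * (t * Y (Suc n) - q * Y n))"
    unfolding ge2 by (simp add: algebra_simps)
  finally show ?case
    using X[of n] Y[of n] by simp
qed simp

text \<open>With \<open>a + b\<close> kept fixed, the bracket on the left solves the recurrence as a
  function of \<open>b\<close> and vanishes at \<open>b = 0\<close>, hence is proportional to
  \<open>U\<close>.\<close>

lemma linear_recurrence_product:
  fixes U W :: "nat \<Rightarrow> real"
  assumes U: "\<And>n. U (n + 2) = t * U (n + 1) - q * U n" and U0: "U 0 = 0"
    and W: "\<And>n. W (n + 2) = t * W (n + 1) - q * W n"
  shows "U 1 * (W b * W (a + b) - q ^ b * W 0 * W a) =
    U b * (W 1 * W (a + b) - q * W 0 * W (a + b - 1))"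
proof (induction b arbitrary: a rule: induct_nat_012)
  case (ge2 n)
  have eqs: "W (Suc (Suc n)) = t * W (Suc n) - q * W n"
    "U (Suc (Suc n)) = t * U (Suc n) - q * U n"
    "q * W a = t * W (Suc a) - W (Suc (Suc a))"
    using W[of n] U[of n] W[of a] by simp_all
  let ?s = "a + Suc (Suc n)"
  have "W (Suc (Suc n)) * W ?s - q ^ Suc (Suc n) * W 0 * W a =
    t * (W (Suc n) * W ?s - q ^ Suc n * W 0 * W (Suc a))
    - q * (W n * W ?s - q ^ n * W 0 * W (Suc (Suc a)))"
  proof -
    have "q ^ Suc (Suc n) * W 0 * W a = q ^ Suc n * W 0 * (q * W a)" by simp
    then show ?thesis unfolding eqs by (simp add: algebra_simps)
  qed
  then have "U 1 * (W (Suc (Suc n)) * W ?s - q ^ Suc (Suc n) * W 0 * W a) =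
    t * (U 1 * (W (Suc n) * W ?s - q ^ Suc n * W 0 * W (Suc a)))
    - q * (U 1 * (W n * W ?s - q ^ n * W 0 * W (Suc (Suc a))))"
    by (simp only: right_diff_distrib mult.left_commute[of "U 1"])
  also have "\<dots> = t * (U (Suc n) * (W 1 * W ?s - q * W 0 * W (?s - 1)))
    - q * (U n * (W 1 * W ?s - q * W 0 * W (?s - 1)))"
    using ge2(1)[of "Suc (Suc a)"] ge2(2)[of "Suc a"] by simp
  also have "\<dots> = U (Suc (Suc n)) * (W 1 * W ?s - q * W 0 * W (?s - 1))"
    unfolding eqs by (simp add: algebra_simps)
  finally show ?case .
qed (simp_all add: U0)

text \<open>The Casoratian identity evaluates the difference of the quotients at
  \<open>a + b\<close> and \<open>b\<close>; comparing it with \<open>U a / W a\<close> comes down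
  to the sign in the product identity, which \<open>Z\<close> provides.\<close>

lemma quotient_strict_subadditive:
  fixes U W :: "nat \<Rightarrow> real"
  assumes U: "\<And>n. U (n + 2) = t * U (n + 1) - q * U n" and U0: "U 0 = 0"
    and W: "\<And>n. W (n + 2) = t * W (n + 1) - q * W n"
    and pos: "\<And>s. 1 \<le> s \<Longrightarrow> s \<le> P \<Longrightarrow> U s > 0" "\<And>s. s \<le> P \<Longrightarrow> W s > 0"
    and Z: "\<And>s. 2 \<le> s \<Longrightarrow> s \<le> P \<Longrightarrow> W 1 * W s - q * W 0 * W (s - 1) > 0"
    and ab: "1 \<le> a" "1 \<le> b" "a + b \<le> P"
  shows "U (a + b) / W (a + b) < U a / W a + U b / W b"
proof -
  have W_pos: "W a > 0" "W b > 0" "W (a + b) > 0" and U_pos: "U a > 0" "U b > 0" "U 1 > 0"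
    using ab pos by auto
  have "U (a + b) * W b - U b * W (a + b) = q ^ b * U a * W 0"
    using linear_recurrence_casoratian[of U t q W a b] U W U0 by (simp add: algebra_simps)
  then have "U (a + b) / W (a + b) - U b / W b = U a * (q ^ b * W 0) / (W (a + b) * W b)"
    using W_pos by (simp add: field_simps)
  also have "\<dots> < U a / W a"
  proof -
    have "U 1 * (W b * W (a + b) - q ^ b * W 0 * W a) > 0"
      unfolding linear_recurrence_product[of U t q W, OF U U0 W]
      using Z[of "a + b"] ab U_pos by (intro mult_pos_pos) auto
    then have "q ^ b * W 0 * W a < W b * W (a + b)"
      using U_pos by (simp add: zero_less_mult_iff)
    then show ?thesis
      using W_pos U_pos by (simp add: field_simps)
  qed
  finally show ?thesis by simp
qed

text \<open>The map \<open>h \<mapsto> \<alpha> + (1 - \<alpha>)\<^sup>2 / (l - \<alpha> - h)\<close> is a Moebius transformation;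
  \<open>pw_num\<close> and \<open>pw_den\<close> are the entries of the powers of its matrix, which makes both of them
  solutions of one linear recurrence.\<close>

primrec path_weight :: "real \<Rightarrow> real \<Rightarrow> nat \<Rightarrow> real" where
  "path_weight \<alpha> l 0 = 0"
| "path_weight \<alpha> l (Suc n) = \<alpha> + (1 - \<alpha>)\<^sup>2 / (l - \<alpha> - path_weight \<alpha> l n)"

fun pw_num pw_den :: "real \<Rightarrow> real \<Rightarrow> nat \<Rightarrow> real" where
  "pw_num \<alpha> l 0 = 0"
| "pw_num \<alpha> l (Suc n) = (\<alpha> * (l - \<alpha>) + (1 - \<alpha>)\<^sup>2) * pw_den \<alpha> l n - \<alpha> * pw_num \<alpha> l n"
| "pw_den \<alpha> l 0 = 1"
| "pw_den \<alpha> l (Suc n) = (l - \<alpha>) * pw_den \<alpha> l n - pw_num \<alpha> l n"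

text \<open>Cayley-Hamilton: the coefficients are the trace and the determinant of the matrix of the
  Moebius transformation.\<close>

lemma pw_recurrence:
  "pw_num \<alpha> l (n + 2) = (l - 2 * \<alpha>) * pw_num \<alpha> l (n + 1) - (1 - \<alpha>)\<^sup>2 * pw_num \<alpha> l n"
  "pw_den \<alpha> l (n + 2) = (l - 2 * \<alpha>) * pw_den \<alpha> l (n + 1) - (1 - \<alpha>)\<^sup>2 * pw_den \<alpha> l n"
  by (simp_all add: power2_eq_square algebra_simps)

locale path_weights =
  fixes \<alpha> l :: real and P :: nat
  assumes \<alpha>0: "0 \<le> \<alpha>" and \<alpha>1: "\<alpha> < 1"
    and step_pos: "\<And>n. n < P \<Longrightarrow> path_weight \<alpha> l n < l - \<alpha>"
begin

abbreviation "h \<equiv> path_weight \<alpha> l"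
abbreviation "num \<equiv> pw_num \<alpha> l"
abbreviation "den \<equiv> pw_den \<alpha> l"

lemma den_pos_num: "n \<le> P \<Longrightarrow> den n > 0 \<and> num n = h n * den n"
proof (induction n)
  case (Suc n)
  then have IH: "den n > 0" "num n = h n * den n" and lt: "h n < l - \<alpha>"
    using step_pos[of n] by auto
  have den: "den (Suc n) = (l - \<alpha> - h n) * den n"
    using IH by (simp add: algebra_simps)
  have "num (Suc n) = \<alpha> * den (Suc n) + (1 - \<alpha>)\<^sup>2 * den n"
    by (simp add: algebra_simps)
  also have "\<dots> = h (Suc n) * den (Suc n)"
    using lt unfolding den by (simp add: divide_simps) (simp add: algebra_simps)
  finally show ?case
    using den IH lt by simp
qed simp

lemma den_pos: "n \<le> P \<Longrightarrow> den n > 0"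
  and h_eq: "n \<le> P \<Longrightarrow> h n = num n / den n"
  using den_pos_num[of n] by (auto simp: field_simps)

lemma h_step_mono: "n < P \<Longrightarrow> h n \<le> h (Suc n)"
proof (induction n)
  case 0
  then show ?case using step_pos[of 0] \<alpha>0 by simp
next
  case (Suc n)
  then have "h n \<le> h (Suc n)" "h n < l - \<alpha>" "h (Suc n) < l - \<alpha>"
    using step_pos by (auto simp del: path_weight.simps)
  then have "(1 - \<alpha>)\<^sup>2 / (l - \<alpha> - h n) \<le> (1 - \<alpha>)\<^sup>2 / (l - \<alpha> - h (Suc n))"
    by (intro divide_left_mono) auto
  then show ?case
    by (simp only: path_weight.simps add_le_cancel_left)
qed

lemma h_mono: "m \<le> n \<Longrightarrow> n \<le> P \<Longrightarrow> h m \<le> h n"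
  by (induction rule: dec_induct) (use h_step_mono in \<open>auto simp del: path_weight.simps intro: order_trans\<close>)

lemma h_nonneg: "n \<le> P \<Longrightarrow> 0 \<le> h n"
  using h_mono[of 0 n] by simp

lemma h_pos: "1 \<le> n \<Longrightarrow> n \<le> P \<Longrightarrow> \<alpha> < h n"
  using step_pos[of "n - 1"] \<alpha>1 by (cases n) auto

lemma num_pos: "1 \<le> n \<Longrightarrow> n \<le> P \<Longrightarrow> num n > 0"
  using den_pos_num[of n] h_pos[of n] \<alpha>0 by auto

text \<open>The condition \<open>Z\<close> becomes \<open>h s < l\<close> here. The assumption on
  \<open>h P\<close> goes one step beyond \<open>step_pos\<close>; it is available for
  \<open>q = 2\<close>.\<close>

lemma h_strict_subadditive:
  assumes "h P < l - \<alpha>" and ab: "1 \<le> a" "1 \<le> b" "a + b \<le> P"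
  shows "h (a + b) < h a + h b"
proof -
  have "num (a + b) / den (a + b) < num a / den a + num b / den b"
  proof (rule quotient_strict_subadditive[OF pw_recurrence(1) _ pw_recurrence(2)])
    fix s assume s: "2 \<le> s" "s \<le> P"
    then obtain r where r: "s = Suc r" by (cases s) auto
    have "den 1 * den s - (1 - \<alpha>)\<^sup>2 * den 0 * den (s - 1) = (l - h s) * den s"
    proof -
      have "den 1 * den s - (1 - \<alpha>)\<^sup>2 * den 0 * den (s - 1) = l * den s - num s"
        unfolding r by (simp add: algebra_simps)
      then show ?thesis using den_pos_num[of s] s by (simp add: algebra_simps)
    qed
    moreover have "h s < l" using h_mono[of s P] s assms \<alpha>0 by simp
    ultimately show "den 1 * den s - (1 - \<alpha>)\<^sup>2 * den 0 * den (s - 1) > 0"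
      using den_pos[of s] s by simp
  qed (use den_pos num_pos ab in auto)
  then show ?thesis using h_eq ab by simp
qed

end

text \<open>Strictness needs two positive arguments, so the exception is that a single index carries
  the whole sum; all other terms are then \<open>f 0 = 0\<close>.\<close>

lemma sum_strict_subadditive:
  fixes f :: "nat \<Rightarrow> real" and p :: "'a \<Rightarrow> nat"
  assumes "finite K" "K \<noteq> {}" and f0: "f 0 = 0"
    and sub: "\<And>a b. 1 \<le> a \<Longrightarrow> 1 \<le> b \<Longrightarrow> a + b \<le> P \<Longrightarrow> f (a + b) < f a + f b"
    and "sum p K \<le> P"
  shows "(\<exists>i\<in>K. p i = sum p K) \<or> f (sum p K) < (\<Sum>i\<in>K. f (p i))"
  using assms(1,2,5)
proof (induction K rule: finite_ne_induct)
  case (insert i K)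
  let ?s = "sum p K"
  have IH: "(\<exists>j\<in>K. p j = ?s) \<or> f ?s < (\<Sum>j\<in>K. f (p j))"
    using insert by simp
  have le: "f ?s \<le> (\<Sum>j\<in>K. f (p j))"
  proof (cases "\<exists>j\<in>K. p j = ?s")
    case True
    then obtain j where j: "j \<in> K" "p j = ?s" by blast
    then have "sum p (K - {j}) = 0"
      using insert.hyps by (simp add: sum_diff1_nat)
    then have "\<forall>k\<in>K - {j}. p k = 0"
      using insert.hyps by simp
    then have "(\<Sum>k\<in>K. f (p k)) = f (p j)"
      using j insert.hyps f0 by (subst sum.remove[of _ j]) auto
    then show ?thesis using j by simp
  qed (use IH in auto)
  consider "p i = 0" | "?s = 0" | "1 \<le> p i" "1 \<le> ?s" by linarith
  then show ?case
  proof cases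
    case 1
    then show ?thesis using IH insert.hyps f0 by auto
  next
    case 2
    then show ?thesis using insert.hyps by auto
  next
    case 3
    then have "f (p i + ?s) < f (p i) + f ?s"
      using sub insert by simp
    then show ?thesis using le insert.hyps by simp
  qed
qed auto

section \<open>The clique equation of a kite\<close>

locale clique_path_weights = path_weights +
  fixes q :: nat
  assumes q2: "2 \<le> q"
    and h_lt: "path_weight \<alpha> l P < l - \<alpha> * q + 1"
    and clique_eq: "(1 - \<alpha>) / (l - \<alpha> * q + 1 - path_weight \<alpha> l P)
      + (q - 1) * (1 - \<alpha>) / (l - \<alpha> * q + 1) = 1"
begin

text \<open>Completing the sum over the clique neighbours of a clique vertex by its own entry
  changes \<open>l - \<alpha> * (q - 1)\<close> into
  \<open>l - \<alpha> * (q - 1) + (1 - \<alpha>)\<close>, which is \<open>L\<close>. Then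
  \<open>clique_eq\<close> says that the shares of the clique vertices of the kite in their sum add
  up to 1.\<close>

abbreviation "L \<equiv> l - \<alpha> * q + 1"

text \<open>The contribution of a clique vertex with a path of order \<open>n\<close> attached to the clique equation
  exceeds that of a clique vertex of degree \<open>q - 1\<close> by \<open>(1 - \<alpha>) / L\<close> times this.\<close>

definition excess :: "nat \<Rightarrow> real" where
  "excess n = h n / (L - h n)"

lemma L_pos: "L > 0"
  using h_lt h_nonneg[of P] by simp

lemma h_lt_L: "n \<le> P \<Longrightarrow> h n < L"
  using h_lt h_mono[of n P] by simp

lemma clique_excess: "n \<le> P \<Longrightarrow> (1 - \<alpha>) / (L - h n) = (1 - \<alpha>) / L * (1 + excess n)"
proof -
  assume n: "n \<le> P"
  have "1 + x / (A - x) = A / (A - x)" if "x < A" for x A :: real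
    using that by (simp add: divide_simps)
  from this[OF h_lt_L[OF n]] show ?thesis
    using L_pos by (simp add: excess_def)
qed

lemma clique_poly: "L * (l - q + 1) = h P * (l - q + 1 + (1 - \<alpha>))"
proof -
  have "(1 - \<alpha>) * L + (q - 1) * (1 - \<alpha>) * (L - h P) = (L - h P) * L"
    using clique_eq L_pos h_lt by (simp add: field_simps)
  moreover have "real (q - 1) = real q - 1" using q2 by simp
  ultimately show ?thesis by (simp add: algebra_simps)
qed

lemma h_P_lt_step: "h P < l - \<alpha>" if "q = 2"
proof -
  have "(1 - \<alpha>) / L > 0" using \<alpha>1 L_pos by simp
  then have "(1 - \<alpha>) / (L - h P) < 1"
    using clique_eq that by simp
  then show ?thesis using h_lt that by (simp add: field_simps)
qed

text \<open>The bound is the spectral radius of the complete graph on \<open>q\<close> vertices. The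
  second summand of \<open>clique_eq\<close> is below 1, which makes the cofactor of
  \<open>h P\<close> in \<open>clique_poly\<close> positive; this settles the sign of
  \<open>l - q + 1\<close>.\<close>

lemma l_ge: "q - 1 \<le> l"
proof -
  have "(1 - \<alpha>) / (L - h P) > 0" using \<alpha>1 h_lt by simp
  then have "(q - 1) * (1 - \<alpha>) / L < 1"
    using clique_eq by linarith
  then have "(q - 1) * (1 - \<alpha>) < L"
    using L_pos by (simp add: field_simps)
  then have "l - q + 1 + (1 - \<alpha>) > 0"
    using q2 by (simp add: of_nat_diff algebra_simps)
  then have "L * (l - q + 1) \<ge> 0"
    unfolding clique_poly using h_nonneg[of P] by simp
  then show ?thesis
    using L_pos q2 by (simp add: zero_le_mult_iff)
qed

text \<open>\<open>excess\<close> is the quotient of \<open>num\<close> by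
  \<open>w = L * den - num\<close>, which solves the same recurrence, so positivity of
  \<open>z\<close> is what matters. The assumption \<open>3 \<le> q\<close> enters through
  \<open>k > 0\<close>, which gives \<open>w 1 > \<beta> * w 0\<close>, and through
  \<open>l - 2 * \<alpha> \<ge> 2 * \<beta>\<close>.\<close>

lemma excess_strict_subadditive:
  assumes q3: "3 \<le> q" and ab: "1 \<le> a" "1 \<le> b" "a + b \<le> P"
  shows "excess (a + b) < excess a + excess b"
proof -
  define \<beta> where "\<beta> = 1 - \<alpha>"
  define \<delta> where "\<delta> = l - q + 1"
  define k where "k = real q - 2"
  define w where "w n = L * den n - num n" for n
  define z where "z n = w 1 * w (Suc n) - \<beta>\<^sup>2 * w 0 * w n" for n
  have \<beta>: "\<beta> > 0" and k: "k > 0" using \<alpha>1 q3 by (auto simp: \<beta>_def k_def)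
  have w_eq: "w n = (L - h n) * den n" if "n \<le> P" for n
    using den_pos_num[OF that] by (simp add: w_def algebra_simps)
  have w_pos: "w n > 0" if "n \<le> P" for n
    using that w_eq h_lt_L den_pos by simp
  have w_rec: "w (n + 2) = (l - 2 * \<alpha>) * w (n + 1) - \<beta>\<^sup>2 * w n" for n
    unfolding w_def \<beta>_def pw_recurrence by (simp only: algebra_simps)
  have excess_w: "excess n = num n / w n" if "n \<le> P" for n
    using den_pos_num[OF that] h_lt_L[OF that] unfolding w_eq[OF that] by (simp add: excess_def)
  have \<delta>: "\<delta> > 0"
  proof -
    have "h P > 0" using h_pos[of P] \<alpha>0 ab by simp
    then have "L * \<delta> > 0"
      using clique_poly l_ge \<beta> q3 by (simp add: \<delta>_def \<beta>_def)
    then show ?thesis using L_pos by (simp add: zero_less_mult_iff)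
  qed
  define c where "c = \<alpha> * (l - \<alpha>) + \<beta>\<^sup>2"
  have l\<alpha>: "l - \<alpha> = \<delta> + \<beta> + k" by (simp add: \<delta>_def \<beta>_def k_def)
  have c: "c > 0" unfolding c_def l\<alpha> using \<alpha>0 \<beta> \<delta> k by (simp add: add_nonneg_pos)
  \<comment> \<open>Start from \<open>h 1 \<le> h P\<close> and eliminate \<open>h P\<close> by
    \<open>clique_poly\<close>. Strictness comes from
    \<open>(\<delta> + k) * (\<delta> + \<beta>)\<close> exceeding
    \<open>\<delta> * (\<delta> + \<beta> + k)\<close> by \<open>k * \<beta>\<close>.\<close>
  have w1: "w 1 > \<beta> * w 0"
  proof -
    have "h 1 = c / (l - \<alpha>)"
      using l\<alpha> \<beta> \<delta> k by (simp add: c_def \<beta>_def[symmetric] add_divide_distrib)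
    then have "c / (l - \<alpha>) \<le> h P" using h_mono[of 1 P] ab by simp
    then have "c \<le> h P * (\<delta> + \<beta> + k)"
      using l\<alpha> \<beta> \<delta> k by (simp add: field_simps)
    then have "c * (\<delta> + \<beta>) \<le> h P * (\<delta> + \<beta> + k) * (\<delta> + \<beta>)"
      using \<beta> \<delta> by (intro mult_right_mono) auto
    also have "\<dots> = (h P * (\<delta> + \<beta>)) * (\<delta> + \<beta> + k)"
      by (simp only: ac_simps)
    also have "h P * (\<delta> + \<beta>) = L * \<delta>"
      using clique_poly by (simp add: \<delta>_def \<beta>_def)
    also have "L * \<delta> * (\<delta> + \<beta> + k) < L * ((\<delta> + k) * (\<delta> + \<beta>))"
      unfolding mult.assoc
      using L_pos \<beta> k by (intro mult_strict_left_mono) (simp_all add: algebra_simps)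
    finally have "c < L * (\<delta> + k)" using \<beta> \<delta> by (simp add: mult.assoc[symmetric])
    moreover have "w 1 - \<beta> * w 0 = L * (\<delta> + k) - c"
      using l\<alpha> unfolding w_def c_def \<beta>_def by (simp add: algebra_simps)
    ultimately show ?thesis by simp
  qed
  have t: "l - 2 * \<alpha> \<ge> 2 * \<beta>" using l_ge q3 by (simp add: \<beta>_def)
  have w0: "w 0 > 0" using w_pos by simp
  \<comment> \<open>\<open>z\<close> solves the recurrence of \<open>w\<close>. As its first
    coefficient is at least \<open>2 * \<beta>\<close> and the other one is
    \<open>\<beta>\<^sup>2\<close>, a growth factor of at least \<open>\<beta>\<close> is passed on
    from step to step.\<close>
  have z: "z n > 0 \<and> z (Suc n) \<ge> \<beta> * z n" for n
  proof (induction n)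
    case 0
    have "(\<beta> * w 0)\<^sup>2 < (w 1)\<^sup>2"
      using w1 w0 \<beta> by (intro power_strict_mono) auto
    then have "z 0 > 0" by (simp add: z_def power2_eq_square algebra_simps)
    moreover have "z 1 - \<beta> * z 0 = \<beta> * (w 1 - \<beta> * w 0)\<^sup>2 + (l - 2 * \<alpha> - 2 * \<beta>) * (w 1)\<^sup>2"
    proof -
      have w2: "w (Suc (Suc 0)) = (l - 2 * \<alpha>) * w (Suc 0) - \<beta>\<^sup>2 * w 0"
        using w_rec[of 0] by (simp add: numeral_2_eq_2)
      show ?thesis
        unfolding z_def One_nat_def w2 by (simp add: power2_eq_square algebra_simps)
    qed
    moreover have "0 \<le> \<beta> * (w 1 - \<beta> * w 0)\<^sup>2 + (l - 2 * \<alpha> - 2 * \<beta>) * (w 1)\<^sup>2"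
      using t \<beta> by (intro add_nonneg_nonneg mult_nonneg_nonneg) auto
    ultimately show ?case by simp
  next
    case (Suc n)
    have "z (Suc (Suc n)) = (l - 2 * \<alpha>) * z (Suc n) - \<beta>\<^sup>2 * z n"
    proof -
      have eqs: "w (Suc (Suc n)) = (l - 2 * \<alpha>) * w (Suc n) - \<beta>\<^sup>2 * w n"
        "w (Suc (Suc (Suc n))) = (l - 2 * \<alpha>) * w (Suc (Suc n)) - \<beta>\<^sup>2 * w (Suc n)"
        using w_rec[of n] w_rec[of "Suc n"] by simp_all
      show ?thesis
        unfolding z_def eqs(2) unfolding eqs(1) by (simp add: algebra_simps)
    qed
    moreover have zS: "z (Suc n) > 0"
      using Suc \<beta> by (meson less_le_trans mult_pos_pos)
    moreover have "(l - 2 * \<alpha>) * z (Suc n) \<ge> 2 * \<beta> * z (Suc n)"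
      using t zS by (intro mult_right_mono) auto
    moreover have "\<beta> * z (Suc n) \<ge> \<beta> * (\<beta> * z n)"
      using Suc \<beta> by (intro mult_left_mono) auto
    ultimately show ?case by (simp add: power2_eq_square algebra_simps)
  qed
  have "num (a + b) / w (a + b) < num a / w a + num b / w b"
  proof (rule quotient_strict_subadditive[OF pw_recurrence(1) _ w_rec[unfolded \<beta>_def]])
    fix s assume s: "2 \<le> s" "s \<le> P"
    show "w 1 * w s - (1 - \<alpha>)\<^sup>2 * w 0 * w (s - 1) > 0"
      using z[of "s - 1"] s by (simp add: z_def \<beta>_def)
  qed (use w_pos num_pos ab in auto)
  then show ?thesis using excess_w ab by simp
qed

text \<open>For \<open>3 \<le> q\<close> the claim is pulled back from \<open>excess\<close>,
  because \<open>s / (L - s)\<close> is increasing in \<open>s\<close>, and superadditive on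
  nonnegative arguments with sum below \<open>L\<close>. If \<open>h a + h b \<ge> L\<close>, then
  \<open>h (a + b) < L\<close> suffices.\<close>

lemma h_strict_subadditive':
  assumes ab: "1 \<le> a" "1 \<le> b" "a + b \<le> P"
  shows "h (a + b) < h a + h b"
proof (cases "q = 2 \<or> h a + h b \<ge> L")
  case True
  then show ?thesis
    using h_P_lt_step h_strict_subadditive[OF _ ab] h_lt_L[OF ab(3)] by linarith
next
  case False
  then have lt: "h a + h b < L" and q3: "3 \<le> q" using q2 by auto
  have h: "0 \<le> h a" "0 \<le> h b" using h_nonneg ab by auto
  have "h (a + b) / (L - h (a + b)) < h a / (L - h a) + h b / (L - h b)"
    using excess_strict_subadditive[OF q3 ab] by (simp add: excess_def)
  also have "\<dots> \<le> h a / (L - (h a + h b)) + h b / (L - (h a + h b))"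
    using h lt by (intro add_mono divide_left_mono) auto
  also have "\<dots> = (h a + h b) / (L - (h a + h b))"
    by (simp add: add_divide_distrib)
  finally have "h (a + b) * (L - (h a + h b)) < (h a + h b) * (L - h (a + b))"
    using lt h_lt_L[OF ab(3)] by (simp add: field_simps)
  then have "h (a + b) * L < (h a + h b) * L" by (simp add: algebra_simps)
  then show ?thesis using L_pos by simp
qed

end

section \<open>Perron vectors of symmetric matrices\<close>

text \<open>Tychonoff's theorem in the function type; it provides the compact set on which a
  quadratic form attains its maximum.\<close>

lemma compact_PiE_UNIV:
  fixes S :: "'a \<Rightarrow> real set"
  assumes "\<And>i. compact (S i)"
  shows "compact {x. \<forall>i. x i \<in> S i}"
proof -
  have "compactin (product_topology (\<lambda>_. euclidean) UNIV) (PiE UNIV S)"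
    by (subst compactin_PiE) (use assms in simp)
  moreover have "PiE UNIV S = {x. \<forall>i. x i \<in> S i}" by auto
  ultimately show ?thesis
    by (simp add: euclidean_product_topology)
qed

lemma rayleigh_maximum:
  fixes M :: "'a \<Rightarrow> 'a \<Rightarrow> real"
  assumes "finite V" "V \<noteq> {}"
  obtains x where "(\<Sum>v\<in>V. (x v)\<^sup>2) = 1"
    "\<And>y. (\<Sum>v\<in>V. \<Sum>u\<in>V. M v u * y v * y u)
      \<le> (\<Sum>v\<in>V. \<Sum>u\<in>V. M v u * x v * x u) * (\<Sum>v\<in>V. (y v)\<^sup>2)"
proof -
  define Q where "Q y = (\<Sum>v\<in>V. \<Sum>u\<in>V. M v u * y v * y u)" for y :: "'a \<Rightarrow> real"
  define N where "N y = (\<Sum>v\<in>V. (y v)\<^sup>2)" for y :: "'a \<Rightarrow> real"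
  \<comment> \<open>Entries outside \<open>V\<close> are fixed to 0: \<open>N\<close> does not see
    them, so its unit sphere alone need not be compact.\<close>
  define B where "B = {x :: 'a \<Rightarrow> real. \<forall>v. x v \<in> (if v \<in> V then {-1..1} else {0})}"
  have "compact B" unfolding B_def by (rule compact_PiE_UNIV) auto
  have cont: "continuous_on X (\<lambda>x :: 'a \<Rightarrow> real. x v)" for X v
    by (rule continuous_on_subset[OF continuous_on_product_coordinates subset_UNIV])
  have cQ: "continuous_on X Q" and cN: "continuous_on X N" for X
    unfolding Q_def N_def by (intro continuous_on_sum continuous_on_mult
      continuous_on_power continuous_on_const cont)+
  have "closed (N -` {1})"
    using cN[of UNIV] by (intro closed_vimage) auto
  then have "compact (B \<inter> N -` {1})" using \<open>compact B\<close> by (rule compact_Int_closed[rotated])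
  moreover have "B \<inter> N -` {1} \<noteq> {}"
  proof -
    obtain v where v: "v \<in> V" using assms by blast
    have "N (\<lambda>u. if u = v then 1 else 0) = 1"
      using assms v by (simp add: N_def if_distrib[of "\<lambda>x. x\<^sup>2"] cong: if_cong)
    then have "(\<lambda>u. if u = v then 1 else 0) \<in> B \<inter> N -` {1}" using v by (simp add: B_def)
    then show ?thesis by blast
  qed
  ultimately have "\<exists>x\<in>B \<inter> N -` {1}. \<forall>y\<in>B \<inter> N -` {1}. Q y \<le> Q x"
    by (rule continuous_attains_sup[OF _ _ cQ])
  then obtain x where x: "x \<in> B \<inter> N -` {1}" "\<forall>y\<in>B \<inter> N -` {1}. Q y \<le> Q x"
    by (elim bexE)
  have "Q y \<le> Q x * N y" for y
  proof (cases "N y = 0")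
    case True
    then have "\<forall>v\<in>V. y v = 0" using assms by (simp add: N_def sum_nonneg_eq_0_iff)
    then have "Q y = 0" by (simp add: Q_def)
    then show ?thesis using True by simp
  next
    case False
    moreover have "N y \<ge> 0" by (simp add: N_def sum_nonneg)
    ultimately have pos: "N y > 0" by simp
    define s where "s = 1 / sqrt (N y)"
    have s2: "s\<^sup>2 = 1 / N y" using pos by (simp add: s_def power_divide)
    define y' where "y' v = (if v \<in> V then s * y v else 0)" for v
    have "N y' = s\<^sup>2 * N y"
      by (simp add: N_def y'_def power_mult_distrib sum_distrib_left)
    then have N1: "N y' = 1" using s2 pos by simp
    have "\<bar>y' v\<bar> \<le> 1" if "v \<in> V" for v
    proof -
      have "(y' v)\<^sup>2 \<le> N y'"
        unfolding N_def using that assms by (intro member_le_sum) auto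
      then show ?thesis using N1 by (simp add: abs_square_le_1)
    qed
    then have "y' \<in> B" by (auto simp: B_def y'_def abs_le_iff)
    then have "Q y' \<le> Q x" using N1 x(2) by simp
    moreover have "Q y' = s\<^sup>2 * Q y"
      by (simp add: Q_def y'_def power2_eq_square sum_distrib_left ac_simps)
    ultimately show ?thesis using s2 pos by (simp add: field_simps)
  qed
  then show ?thesis
    using that[of x] x(1) by (auto simp: N_def Q_def)
qed

text \<open>Perturbing a maximiser in the direction of its residual gives the first order condition.\<close>

lemma rayleigh_maximiser_eigenvector:
  fixes M :: "'a \<Rightarrow> 'a \<Rightarrow> real"
  assumes "finite V" and sym: "\<And>u v. u \<in> V \<Longrightarrow> v \<in> V \<Longrightarrow> M u v = M v u"
    and le: "\<And>y. (\<Sum>v\<in>V. \<Sum>u\<in>V. M v u * y v * y u) \<le> \<mu> * (\<Sum>v\<in>V. (y v)\<^sup>2)"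
    and eq: "\<mu> * (\<Sum>v\<in>V. (x v)\<^sup>2) \<le> (\<Sum>v\<in>V. \<Sum>u\<in>V. M v u * x v * x u)"
    and "v \<in> V"
  shows "(\<Sum>u\<in>V. M v u * x u) = \<mu> * x v"
proof -
  define Q where "Q y = (\<Sum>v\<in>V. \<Sum>u\<in>V. M v u * y v * y u)" for y :: "'a \<Rightarrow> real"
  define N where "N y = (\<Sum>v\<in>V. (y v)\<^sup>2)" for y :: "'a \<Rightarrow> real"
  define d where "d v = (\<Sum>u\<in>V. M v u * x u) - \<mu> * x v" for v
  have "2 * t * N d \<le> t\<^sup>2 * (\<mu> * N d - Q d)" for t
  proof -
    have swap: "(\<Sum>v\<in>V. \<Sum>u\<in>V. M v u * x v * d u) = (\<Sum>v\<in>V. \<Sum>u\<in>V. M v u * d v * x u)"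
      by (subst sum.swap) (auto intro!: sum.cong simp: sym)
    have "Q (\<lambda>v. x v + t * d v) = Q x + t * (\<Sum>v\<in>V. \<Sum>u\<in>V. M v u * x v * d u)
        + t * (\<Sum>v\<in>V. \<Sum>u\<in>V. M v u * d v * x u) + t\<^sup>2 * Q d"
      unfolding Q_def sum_distrib_left sum.distrib[symmetric]
      by (intro sum.cong refl) (simp add: power2_eq_square algebra_simps)
    moreover have "N (\<lambda>v. x v + t * d v) = N x + 2 * t * (\<Sum>v\<in>V. d v * x v) + t\<^sup>2 * N d"
      unfolding N_def sum_distrib_left sum.distrib[symmetric]
      by (intro sum.cong refl) (simp add: power2_eq_square algebra_simps)
    moreover have "(\<Sum>v\<in>V. \<Sum>u\<in>V. M v u * d v * x u) = N d + \<mu> * (\<Sum>v\<in>V. d v * x v)"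
    proof -
      have "N d + \<mu> * (\<Sum>v\<in>V. d v * x v) = (\<Sum>v\<in>V. d v * (d v + \<mu> * x v))"
        unfolding N_def sum_distrib_left sum.distrib[symmetric]
        by (intro sum.cong refl) (simp add: power2_eq_square algebra_simps)
      also have "\<dots> = (\<Sum>v\<in>V. d v * (\<Sum>u\<in>V. M v u * x u))" by (simp add: d_def)
      also have "\<dots> = (\<Sum>v\<in>V. \<Sum>u\<in>V. M v u * d v * x u)"
        by (simp add: sum_distrib_left ac_simps)
      finally show ?thesis by simp
    qed
    moreover have "Q (\<lambda>v. x v + t * d v) \<le> \<mu> * N (\<lambda>v. x v + t * d v)" "\<mu> * N x \<le> Q x"
      using le eq by (auto simp: Q_def N_def)
    ultimately show ?thesis using swap by (simp add: algebra_simps)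
  qed
  note bound = this
  have "N d \<le> 0"
  proof (rule ccontr)
    assume "\<not> N d \<le> 0"
    define C where "C = \<mu> * N d - Q d"
    \<comment> \<open>So small that \<open>t * C\<close> is at most \<open>N d\<close>, while the
      bound demands at least \<open>2 * N d\<close>.\<close>
    define t where "t = N d / (\<bar>C\<bar> + 1)"
    have t: "t > 0" using \<open>\<not> N d \<le> 0\<close> by (simp add: t_def)
    have "2 * t * N d \<le> t\<^sup>2 * C" using bound[of t] by (simp add: C_def)
    then have "2 * N d \<le> t * C" using t by (simp add: power2_eq_square)
    also have "\<dots> \<le> t * (\<bar>C\<bar> + 1)" using t by (intro mult_left_mono) auto
    also have "\<dots> = N d" by (simp add: t_def)
    finally show False using \<open>\<not> N d \<le> 0\<close> by simp
  qed
  then have "N d = 0" by (simp add: N_def sum_nonneg order_antisym)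
  then have "d v = 0" using assms(1) \<open>v \<in> V\<close> by (simp add: N_def sum_nonneg_eq_0_iff)
  then show ?thesis by (simp add: d_def)
qed

text \<open>As \<open>M\<close> is nonnegative, taking absolute values of a maximiser does not lower
  the quadratic form, so the result is again a maximiser and thus an eigenvector. If some entries
  vanished, irreducibility would give a zero entry coupled to a positive one, against the eigenvalue
  equation.\<close>

lemma symmetric_perron_vector:
  fixes M :: "'a \<Rightarrow> 'a \<Rightarrow> real"
  assumes V: "finite V" "V \<noteq> {}" and sym: "\<And>u v. u \<in> V \<Longrightarrow> v \<in> V \<Longrightarrow> M u v = M v u"
    and nonneg: "\<And>u v. 0 \<le> M u v"
    and irred: "\<And>S. S \<subset> V \<Longrightarrow> S \<noteq> {} \<Longrightarrow> \<exists>u\<in>S. \<exists>v\<in>V - S. M u v > 0"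
  obtains x \<mu> where "\<And>v. v \<in> V \<Longrightarrow> x v > 0" "\<And>v. v \<in> V \<Longrightarrow> (\<Sum>u\<in>V. M v u * x u) = \<mu> * x v"
proof -
  obtain x where x: "(\<Sum>v\<in>V. (x v)\<^sup>2) = 1"
    "\<And>y. (\<Sum>v\<in>V. \<Sum>u\<in>V. M v u * y v * y u)
      \<le> (\<Sum>v\<in>V. \<Sum>u\<in>V. M v u * x v * x u) * (\<Sum>v\<in>V. (y v)\<^sup>2)"
    using rayleigh_maximum[OF V] by blast
  define \<mu> where "\<mu> = (\<Sum>v\<in>V. \<Sum>u\<in>V. M v u * x v * x u)"
  define y where "y v = \<bar>x v\<bar>" for v
  have "\<mu> \<le> (\<Sum>v\<in>V. \<Sum>u\<in>V. M v u * y v * y u)"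
    unfolding \<mu>_def y_def
    by (intro sum_mono)
      (metis abs_ge_self abs_mult abs_of_nonneg nonneg mult.assoc)
  then have eig: "(\<Sum>u\<in>V. M v u * y u) = \<mu> * y v" if "v \<in> V" for v
    using rayleigh_maximiser_eigenvector[of V M \<mu> y v] V sym x that by (simp add: y_def \<mu>_def)
  define S where "S = {v \<in> V. y v > 0}"
  have "S \<noteq> {}"
  proof
    assume "S = {}"
    then have "\<forall>v\<in>V. x v = 0" by (auto simp: S_def y_def)
    then show False using x(1) by simp
  qed
  have "S = V"
  proof (rule ccontr)
    assume "S \<noteq> V"
    then obtain u v where uv: "u \<in> S" "v \<in> V - S" "M u v > 0"
      using irred[of S] \<open>S \<noteq> {}\<close> by (auto simp: S_def)
    then have "M v u * y u > 0" using sym[of u v] by (auto simp: S_def)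
    also have "M v u * y u \<le> (\<Sum>u\<in>V. M v u * y u)"
      using uv V nonneg by (intro member_le_sum) (auto simp: S_def y_def)
    also have "\<dots> = 0" using uv eig[of v] by (auto simp: S_def y_def)
    finally show False by simp
  qed
  then show ?thesis using that[of y \<mu>] eig by (auto simp: S_def)
qed

text \<open>Take moduli in the equation for \<open>z\<close>, sum against the positive vector
  \<open>x\<close>, and move \<open>M\<close> onto \<open>x\<close> by symmetry; the common positive
  factor cancels.\<close>

lemma positive_eigenvector_bounds_eigenvalues:
  fixes M :: "'a \<Rightarrow> 'a \<Rightarrow> real" and z :: "'a \<Rightarrow> complex"
  assumes V: "finite V" and sym: "\<And>u v. u \<in> V \<Longrightarrow> v \<in> V \<Longrightarrow> M u v = M v u"
    and nonneg: "\<And>u v. 0 \<le> M u v"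
    and x: "\<And>v. v \<in> V \<Longrightarrow> x v > 0" "\<And>v. v \<in> V \<Longrightarrow> (\<Sum>u\<in>V. M v u * x u) = \<mu> * x v"
    and z: "\<exists>v\<in>V. z v \<noteq> 0" "\<And>v. v \<in> V \<Longrightarrow> (\<Sum>u\<in>V. complex_of_real (M v u) * z u) = k * z v"
  shows "cmod k \<le> \<mu>"
proof -
  have "cmod k * (\<Sum>v\<in>V. x v * cmod (z v)) = (\<Sum>v\<in>V. x v * cmod (k * z v))"
    by (simp add: sum_distrib_left norm_mult ac_simps)
  also have "\<dots> \<le> (\<Sum>v\<in>V. x v * (\<Sum>u\<in>V. M v u * cmod (z u)))"
  proof (intro sum_mono mult_left_mono)
    fix v assume v: "v \<in> V"
    have "cmod (k * z v) \<le> (\<Sum>u\<in>V. cmod (complex_of_real (M v u) * z u))"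
      unfolding z(2)[OF v, symmetric] by (rule norm_sum)
    then show "cmod (k * z v) \<le> (\<Sum>u\<in>V. M v u * cmod (z u))"
      using nonneg by (simp add: norm_mult)
  qed (use x in \<open>auto simp: less_imp_le\<close>)
  also have "\<dots> = (\<Sum>u\<in>V. (\<Sum>v\<in>V. M u v * x v) * cmod (z u))"
    unfolding sum_distrib_left sum_distrib_right
    by (subst sum.swap) (auto intro!: sum.cong simp: sym)
  also have "\<dots> = (\<Sum>u\<in>V. \<mu> * x u * cmod (z u))"
    by (intro sum.cong refl) (simp add: x(2))
  also have "\<dots> = \<mu> * (\<Sum>v\<in>V. x v * cmod (z v))"
    by (simp add: sum_distrib_left ac_simps)
  finally have le: "cmod k * (\<Sum>v\<in>V. x v * cmod (z v)) \<le> \<mu> * (\<Sum>v\<in>V. x v * cmod (z v))" .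
  obtain v where v: "v \<in> V" "z v \<noteq> 0" using z by blast
  then have "0 < x v * cmod (z v)" using x by simp
  also have "\<dots> \<le> (\<Sum>v\<in>V. x v * cmod (z v))"
    using v V x by (intro member_le_sum) (auto simp: less_imp_le)
  finally show ?thesis using le by simp
qed

section \<open>Connected vertex sets and the Perron vector of a graph\<close>

text \<open>Connectedness of the induced subgraph, phrased by cuts instead of walks: this matches
  the irreducibility assumption of \<open>symmetric_perron_vector\<close> and suits growing a set
  vertex by vertex.\<close>

definition set_connected :: "'a rel \<Rightarrow> 'a set \<Rightarrow> bool" where
  "set_connected E W \<longleftrightarrow> (\<forall>S. S \<subset> W \<longrightarrow> S \<noteq> {} \<longrightarrow> (\<exists>u\<in>S. \<exists>v\<in>W - S. (u, v) \<in> E))"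

lemma set_connectedD:
  "set_connected E W \<Longrightarrow> S \<subseteq> W \<Longrightarrow> S \<noteq> W \<Longrightarrow> S \<noteq> {} \<Longrightarrow> \<exists>u\<in>S. \<exists>v\<in>W - S. (u, v) \<in> E"
  unfolding set_connected_def by blast

lemma set_connected_singleton: "set_connected E {v}"
  unfolding set_connected_def by blast

lemma set_connected_insert:
  assumes "sym E" "set_connected E W" "u \<in> W" "(u, v) \<in> E"
  shows "set_connected E (insert v W)"
  unfolding set_connected_def
proof (intro allI impI)
  fix S assume S: "S \<subset> insert v W" "S \<noteq> {}"
  consider "S \<inter> W = {}" | "S \<inter> W = W" | "S \<inter> W \<noteq> {}" "S \<inter> W \<noteq> W" by blast
  then show "\<exists>u\<in>S. \<exists>v\<in>insert v W - S. (u, v) \<in> E"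
  proof cases
    case 1
    then have "S = {v}" "u \<noteq> v" using S assms(3) by auto
    then show ?thesis using assms by (auto dest: symD)
  next
    case 2
    then have "v \<notin> S" using S by auto
    then show ?thesis using 2 assms by blast
  next
    case 3
    then obtain a b where "a \<in> S \<inter> W" "b \<in> W - (S \<inter> W)" "(a, b) \<in> E"
      using set_connectedD[OF assms(2), of "S \<inter> W"] by auto
    then show ?thesis by blast
  qed
qed

text \<open>Serves to cut a part that falls apart without its attachment vertex \<open>v\<close>: no
  edge runs between the pieces, so each of them is held together through \<open>v\<close>.\<close>

lemma set_connected_split:
  assumes "sym E" "set_connected E (insert v R)" "v \<notin> R" "R1 \<subseteq> R"
    and sep: "\<And>a b. a \<in> R1 \<Longrightarrow> b \<in> R - R1 \<Longrightarrow> (a, b) \<notin> E"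
  shows "set_connected E (insert v R1)"
  unfolding set_connected_def
proof (intro allI impI)
  fix S assume S: "S \<subset> insert v R1" "S \<noteq> {}"
  have sep': "(b, a) \<notin> E" if "a \<in> R1" "b \<in> R - R1" for a b
    using sep[OF that] assms(1) by (auto dest: symD)
  show "\<exists>a\<in>S. \<exists>b\<in>insert v R1 - S. (a, b) \<in> E"
  proof (cases "v \<in> S")
    case True
    \<comment> \<open>Adding all of \<open>R - R1\<close> leaves only \<open>R1 - S\<close> as
      target of an outgoing edge, and by \<open>sep'\<close> its source then lies in
      \<open>S\<close>.\<close>
    have "\<exists>a\<in>S \<union> (R - R1). \<exists>b\<in>insert v R - (S \<union> (R - R1)). (a, b) \<in> E"
      by (rule set_connectedD[OF assms(2)]) (use S assms(3,4) True in auto)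
    then obtain a b where ab: "a \<in> S \<union> (R - R1)" "b \<in> insert v R - (S \<union> (R - R1))" "(a, b) \<in> E"
      by blast
    then have "b \<in> R1 - S" using True by auto
    then show ?thesis using ab sep'[of b a] by blast
  next
    case False
    then have S1: "S \<subseteq> R1" using S by auto
    have "\<exists>a\<in>S. \<exists>b\<in>insert v R - S. (a, b) \<in> E"
      by (rule set_connectedD[OF assms(2)]) (use S assms(3,4) S1 in auto)
    then show ?thesis using S1 sep by blast
  qed
qed

text \<open>A maximal connected proper subset omits only one vertex.\<close>

lemma set_connected_remove_vertex:
  assumes "finite V" "sym E" "set_connected E V" "2 \<le> card V"
  obtains r where "r \<in> V" "set_connected E (V - {r})"
proof -
  define F where "F = {W. W \<subset> V \<and> W \<noteq> {} \<and> set_connected E W}"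
  obtain a where "a \<in> V" using assms(4) by fastforce
  then have "{a} \<in> F" using assms(4) set_connected_singleton[of E a] by (auto simp: F_def)
  moreover have "finite F" using assms(1) by (auto simp: F_def intro: finite_subset[of _ "Pow V"])
  ultimately obtain W where W: "W \<in> F" "\<forall>W'\<in>F. W \<subseteq> W' \<longrightarrow> W' = W"
    using finite_has_maximal[of F] by auto
  then obtain u v where uv: "u \<in> W" "v \<in> V - W" "(u, v) \<in> E"
    using set_connectedD[OF assms(3), of W] unfolding F_def by blast
  have "insert v W \<notin> F" using W(2) uv by blast
  moreover have "set_connected E (insert v W)"
    using W(1) uv assms(2) by (auto simp: F_def intro: set_connected_insert)
  ultimately have "insert v W = V" using W(1) uv unfolding F_def by blast
  then have "V - {v} = W" using uv by auto
  then show ?thesis using that[of v] uv W(1) by (simp add: F_def)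
qed

text \<open>The fibres of \<open>g\<close> grow from the singletons in \<open>K\<close>: if a
  maximal \<open>W\<close> admitting such a map were not \<open>V\<close>, an edge leaving
  \<open>W\<close> would let one more vertex join the fibre of its neighbour.\<close>

lemma set_connected_partition:
  assumes "finite V" "sym E" "set_connected E V" "K \<subseteq> V" "K \<noteq> {}"
  obtains g where "\<And>i. i \<in> K \<Longrightarrow> g i = i" "\<And>v. v \<in> V \<Longrightarrow> g v \<in> K"
    "\<And>i. i \<in> K \<Longrightarrow> set_connected E {v \<in> V. g v = i}"
proof -
  define good where "good W g \<longleftrightarrow> (\<forall>i\<in>K. g i = i) \<and> (\<forall>v\<in>W. g v \<in> K) \<and>
    (\<forall>i\<in>K. set_connected E {v \<in> W. g v = i})" for W and g :: "'a \<Rightarrow> 'a"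
  define F where "F = {W. K \<subseteq> W \<and> W \<subseteq> V \<and> (\<exists>g. good W g)}"
  have "good K (\<lambda>i. i)"
  proof -
    have "{v \<in> K. v = i} = {i}" if "i \<in> K" for i using that by auto
    then show ?thesis by (auto simp: good_def set_connected_singleton)
  qed
  then have "K \<in> F" using assms(4) unfolding F_def by blast
  moreover have "finite F" using assms(1) by (auto simp: F_def intro: finite_subset[of _ "Pow V"])
  ultimately obtain W where W: "W \<in> F" "\<forall>W'\<in>F. W \<subseteq> W' \<longrightarrow> W' = W"
    using finite_has_maximal[of F] by auto
  then obtain g where g: "good W g" and KW: "K \<subseteq> W" "W \<subseteq> V" unfolding F_def by blast
  have "W = V"
  proof (rule ccontr)
    assume "W \<noteq> V"
    moreover have "W \<noteq> {}" using KW assms(5) by auto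
    ultimately obtain u v where uv: "u \<in> W" "v \<in> V - W" "(u, v) \<in> E"
      using set_connectedD[OF assms(3) KW(2)] by blast
    define g' where "g' = g(v := g u)"
    have fib: "{w \<in> insert v W. g' w = i} =
        (if i = g u then insert v {w \<in> W. g w = i} else {w \<in> W. g w = i})" for i
      using uv by (auto simp: g'_def)
    have "set_connected E {w \<in> insert v W. g' w = i}" if "i \<in> K" for i
      unfolding fib using g that uv assms(2)
      by (auto simp: good_def intro: set_connected_insert[of E _ u v])
    moreover have "\<forall>i\<in>K. g' i = i" using g KW uv by (auto simp: g'_def good_def)
    moreover have "\<forall>w\<in>insert v W. g' w \<in> K" using g uv by (auto simp: g'_def good_def)
    ultimately have "good (insert v W) g'" by (simp add: good_def)
    then have "insert v W \<in> F" using KW uv unfolding F_def by blast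
    then show False using W(2) uv by blast
  qed
  then show ?thesis using that[of g] g by (auto simp: good_def)
qed

lemma set_connected_atLeastLessThan:
  assumes "\<And>i. Suc i < n \<Longrightarrow> (i, Suc i) \<in> E \<and> (Suc i, i) \<in> E"
  shows "set_connected E {0..<n}"
  unfolding set_connected_def
proof (intro allI impI)
  fix S assume S: "S \<subset> {0..<n}" "S \<noteq> {}"
  show "\<exists>u\<in>S. \<exists>v\<in>{0..<n} - S. (u, v) \<in> E"
  proof (rule ccontr)
    assume *: "\<not> ?thesis"
    obtain s where s: "s \<in> S" using S by blast
    have up: "Suc i \<in> S" if "i \<in> S" "Suc i < n" for i
    proof -
      have "Suc i \<in> {0..<n}" "(i, Suc i) \<in> E" using that assms[of i] by auto
      then show ?thesis using * that by blast
    qed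
    have down: "i \<in> S" if "Suc i \<in> S" "Suc i < n" for i
    proof -
      have "i \<in> {0..<n}" "(Suc i, i) \<in> E" using that assms[of i] by auto
      then show ?thesis using * that by blast
    qed
    have "t \<in> S" if "t < n" for t
    proof (cases "s \<le> t")
      case True
      then show ?thesis using that
        by (induction rule: dec_induct) (use s up in auto)
    next
      case False
      then have "t \<le> s" by simp
      moreover have "s < n" using s S by auto
      ultimately show ?thesis
        by (induction rule: inc_induct) (use s down in auto)
    qed
    then show False using S by auto
  qed
qed

section \<open>The Perron vector of a connected graph\<close>

abbreviation neighbours :: "'a pair_pre_digraph \<Rightarrow> 'a \<Rightarrow> 'a set" where
  "neighbours G v \<equiv> parcs G `` {v}"

lemma out_degree_neighbours: "out_degree (with_proj G) v = card (neighbours G v)"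
proof -
  have "bij_betw snd (out_arcs (with_proj G) v) (neighbours G v)"
    by (auto simp: bij_betw_def out_arcs_def inj_on_def image_iff)
  then show ?thesis unfolding out_degree_def by (rule bij_betw_same_card)
qed

lemma (in pair_graph) sym_parcs: "sym (parcs G)"
  using arcs_symmetric by (auto intro: symI)

lemma (in pair_graph) connected_set_connected:
  assumes "Digraph_Component.connected (with_proj G)"
  shows "set_connected (parcs G) (pverts G)" "pverts G \<noteq> {}"
proof -
  let ?H = "mk_symmetric (with_proj G)"
  have sc: "strongly_connected ?H"
    using assms by (simp add: Digraph_Component.connected_def)
  then show "pverts G \<noteq> {}" by (auto simp: strongly_connected_def)
  have ends: "parcs ?H = parcs G"
    by (rule adj_mk_symmetric_eq[OF sym_arcs])
  show "set_connected (parcs G) (pverts G)"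
    unfolding set_connected_def
  proof (intro allI impI)
    fix S assume S: "S \<subset> pverts G" "S \<noteq> {}"
    then obtain u v where uv: "u \<in> S" "v \<in> pverts G" "v \<notin> S" by blast
    then have "u \<rightarrow>\<^sup>*\<^bsub>?H\<^esub> v" using sc S by (auto simp: strongly_connected_def)
    then have "(u, v) \<in> rtrancl_on (pverts G) (parcs G)"
      by (simp add: reachable_def ends)
    then have "v \<in> S" if "\<forall>a\<in>S. \<forall>b\<in>pverts G - S. (a, b) \<notin> parcs G"
    proof (induction rule: rtrancl_on_induct)
      case (step a b)
      then show ?case using that by auto
    qed (use uv in auto)
    then show "\<exists>a\<in>S. \<exists>b\<in>pverts G - S. (a, b) \<in> parcs G" using uv by blast
  qed
qed

text \<open>The diagonal term is distributed over the neighbours, one \<open>\<alpha> * x v\<close>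
  each. The eigenvalue of the positive eigenvector lies in the spectrum and bounds all moduli there,
  so it equals \<open>rho \<alpha> G\<close>.\<close>

lemma (in pair_graph) rho_perron_vector:
  assumes \<alpha>: "0 \<le> \<alpha>" "\<alpha> < 1" and conn: "set_connected (parcs G) (pverts G)" and "pverts G \<noteq> {}"
  obtains x where "\<And>v. v \<in> pverts G \<Longrightarrow> x v > 0"
    "\<And>v. v \<in> pverts G \<Longrightarrow> (\<Sum>u\<in>neighbours G v. \<alpha> * x v + (1 - \<alpha>) * x u) = rho \<alpha> G * x v"
proof -
  define M where "M v u = (if u = v then \<alpha> * real (out_degree G v) else 0)
    + (if (v, u) \<in> parcs G then 1 - \<alpha> else 0)" for v u
  let ?V = "pverts G"
  have M_sum: "(\<Sum>u\<in>?V. M v u * x u) = (\<Sum>u\<in>neighbours G v. \<alpha> * x v + (1 - \<alpha>) * x u)"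
    if v: "v \<in> ?V" for v x
  proof -
    have N: "{u \<in> ?V. (v, u) \<in> parcs G} = neighbours G v" using in_arcsD2 by auto
    have "(\<Sum>u\<in>?V. M v u * x u) = (\<Sum>u\<in>?V. (if u = v then \<alpha> * real (out_degree G v) * x v else 0)
      + (if (v, u) \<in> parcs G then (1 - \<alpha>) * x u else 0))"
      by (intro sum.cong) (auto simp: M_def algebra_simps)
    also have "\<dots> = \<alpha> * real (out_degree G v) * x v + (\<Sum>u\<in>neighbours G v. (1 - \<alpha>) * x u)"
      using pair_finite_verts v by (simp add: sum.distrib N flip: sum.inter_filter)
    finally show ?thesis
      by (simp add: sum.distrib out_degree_neighbours)
  qed
  have sym: "M u v = M v u" for u v
    using arcs_symmetric by (auto simp: M_def)
  have nonneg: "0 \<le> M v u" for v u using \<alpha> by (simp add: M_def)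
  obtain x \<mu> where x: "\<And>v. v \<in> ?V \<Longrightarrow> x v > 0" "\<And>v. v \<in> ?V \<Longrightarrow> (\<Sum>u\<in>?V. M v u * x u) = \<mu> * x v"
  proof (rule symmetric_perron_vector[of ?V M])
    fix S assume S: "S \<subset> ?V" "S \<noteq> {}"
    then obtain u v where uv: "u \<in> S" "v \<in> ?V - S" "(u, v) \<in> parcs G"
      using conn unfolding set_connected_def by blast
    then have "M u v > 0" using \<alpha> by (auto simp: M_def add_nonneg_pos)
    then show "\<exists>u\<in>S. \<exists>v\<in>?V - S. M u v > 0" using uv by blast
  qed (use pair_finite_verts assms sym nonneg in auto)
  have vs: "distinct (vertex_list G) \<and> set (vertex_list G) = ?V"
    unfolding vertex_list_def by (rule someI_ex) (use finite_distinct_list[OF pair_finite_verts] in auto)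
  let ?A = "map_mat complex_of_real (A_alpha \<alpha> G (vertex_list G))"
  have spec: "spectrum ?A = {k. \<exists>z. (\<exists>v\<in>?V. z v \<noteq> 0) \<and>
      (\<forall>v\<in>?V. (\<Sum>u\<in>?V. complex_of_real (M v u) * z u) = k * z v)}"
    using spectrum_A_alpha[of "vertex_list G" \<alpha> G] vs by (simp only: M_def)
  have dim: "?A \<in> carrier_mat (length (vertex_list G)) (length (vertex_list G))"
    by (auto simp: A_alpha_def degree_mat_def adjacency_mat_def)
  have "0 < length (vertex_list G)" using vs assms(4) by auto
  note max = spectral_radius_mem_max[OF dim this]
  have "complex_of_real \<mu> \<in> spectrum ?A"
    unfolding spec mem_Collect_eq
  proof (intro exI[of _ "\<lambda>v. complex_of_real (x v)"] conjI ballI)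
    fix v assume "v \<in> ?V"
    then show "(\<Sum>u\<in>?V. complex_of_real (M v u) * complex_of_real (x u)) =
        complex_of_real \<mu> * complex_of_real (x v)"
      using x(2) by (simp flip: of_real_mult of_real_sum)
  qed (use assms(4) x(1) in fastforce)
  then have "cmod (complex_of_real \<mu>) \<le> spectral_radius ?A"
    by (intro max(2)) blast
  moreover have "spectral_radius ?A \<le> \<mu>"
  proof -
    obtain k where k: "k \<in> spectrum ?A" "spectral_radius ?A = cmod k" using max(1) by blast
    then obtain z where "\<exists>v\<in>?V. z v \<noteq> 0"
      "\<forall>v\<in>?V. (\<Sum>u\<in>?V. complex_of_real (M v u) * z u) = k * z v"
      unfolding spec by blast
    then show ?thesis
      using positive_eigenvector_bounds_eigenvalues[OF pair_finite_verts sym nonneg x, of z k] k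
      by simp
  qed
  ultimately have "rho \<alpha> G = \<mu>" by (simp add: rho_def)
  then show ?thesis using that[of x] x M_sum by simp
qed

section \<open>Parts hanging off a vertex\<close>

text \<open>Inequalities suffice, since the Perron vector of \<open>G\<close> has an eigenvalue that
  is merely at most \<open>l\<close>. Subadditivity of \<open>h\<close> is assumed because its proof
  relies on the clique equation, which is not present here.\<close>

locale path_supersolution = path_weights +
  fixes V :: "'a set" and E :: "'a rel" and x :: "'a \<Rightarrow> real"
  assumes fin_V: "finite V" and sym_E: "sym E" and E_V: "E \<subseteq> V \<times> V" and irrefl_E: "irrefl E"
    and x_pos: "\<And>v. v \<in> V \<Longrightarrow> x v > 0"
    and super: "\<And>v. v \<in> V \<Longrightarrow> (\<Sum>u\<in>E `` {v}. \<alpha> * x v + (1 - \<alpha>) * x u) \<le> l * x v"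
    and h_subadd: "\<And>a b. 1 \<le> a \<Longrightarrow> 1 \<le> b \<Longrightarrow> a + b \<le> P \<Longrightarrow>
      path_weight \<alpha> l (a + b) < path_weight \<alpha> l a + path_weight \<alpha> l b"
begin

text \<open>A summand of \<open>super\<close> at \<open>v\<close>, divided by \<open>x v\<close>;
  thus \<open>super\<close> bounds the sum of these over all neighbours by \<open>l\<close>.\<close>

definition ratio :: "'a \<Rightarrow> 'a \<Rightarrow> real" where
  "ratio v u = \<alpha> + (1 - \<alpha>) * (x u / x v)"

definition load :: "'a \<Rightarrow> 'a set \<Rightarrow> real" where
  "load v B = (\<Sum>u\<in>E `` {v} \<inter> B. ratio v u)"

text \<open>The enumeration starts at the far end, so that the attachment vertex comes last, as in
  \<open>PK\<close>. The first conjunct keeps \<open>R\<close> apart from the rest of the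
  graph.\<close>

definition path_from :: "'a \<Rightarrow> 'a set \<Rightarrow> bool" where
  "path_from v R \<longleftrightarrow> (\<forall>u\<in>R. E `` {u} \<subseteq> insert v R) \<and>
    (\<exists>f. bij_betw f {0..card R} (insert v R) \<and> f (card R) = v \<and>
      (\<forall>i\<le>card R. \<forall>j\<le>card R. (f i, f j) \<in> E \<longleftrightarrow> j = Suc i \<or> i = Suc j))"

lemma E_sym: "(u, v) \<in> E \<Longrightarrow> (v, u) \<in> E"
  using sym_E by (rule symD)

lemma E_verts: "(u, v) \<in> E \<Longrightarrow> u \<in> V" "(u, v) \<in> E \<Longrightarrow> v \<in> V"
  using E_V by auto

lemma E_irrefl: "(v, v) \<notin> E"
  using irrefl_E by (auto simp: irrefl_def)

lemma fin_E: "finite (E `` {v})"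
  by (rule finite_subset[OF _ fin_V]) (use E_verts in auto)

lemma ratio_pos: "u \<in> V \<Longrightarrow> v \<in> V \<Longrightarrow> ratio v u > 0"
  using \<alpha>0 \<alpha>1 x_pos by (simp add: ratio_def add_nonneg_pos)

lemma load_le:
  assumes "v \<in> V"
  shows "load v B \<le> l" "\<not> E `` {v} \<subseteq> B \<Longrightarrow> load v B < l"
proof -
  have "x v * load v UNIV = (\<Sum>u\<in>E `` {v}. \<alpha> * x v + (1 - \<alpha>) * x u)"
  proof -
    have "x v * ratio v u = \<alpha> * x v + (1 - \<alpha>) * x u" for u
      using x_pos[OF assms] by (simp add: ratio_def distrib_left)
    then show ?thesis by (simp add: load_def sum_distrib_left)
  qed
  then have "x v * load v UNIV \<le> x v * l"
    using super[OF assms] by (simp add: mult.commute)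
  then have UNIV: "load v UNIV \<le> l"
    using x_pos[OF assms] by simp
  have nonneg: "0 \<le> ratio v u" if "u \<in> E `` {v}" for u
    using ratio_pos assms that E_verts by (auto simp: less_imp_le)
  have "load v B \<le> load v UNIV"
    unfolding load_def using fin_E nonneg by (intro sum_mono2) auto
  then show "load v B \<le> l" using UNIV by simp
  assume "\<not> E `` {v} \<subseteq> B"
  then obtain u where u: "u \<in> E `` {v}" "u \<notin> B" by blast
  have "load v B < load v UNIV"
    unfolding load_def
    by (rule sum_strict_mono2[of _ _ u]) (use u fin_E nonneg ratio_pos[of u v] assms E_verts in auto)
  then show "load v B < l" using UNIV by simp
qed

lemma load_Un:
  assumes "A \<inter> B = {}"
  shows "load v (A \<union> B) = load v A + load v B"
proof -
  have "E `` {v} \<inter> (A \<union> B) = (E `` {v} \<inter> A) \<union> (E `` {v} \<inter> B)" by blast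
  then show ?thesis unfolding load_def using fin_E assms
    by (simp only:) (rule sum.union_disjoint; auto)
qed

lemma load_nonneg: "v \<in> V \<Longrightarrow> 0 \<le> load v B"
  unfolding load_def by (intro sum_nonneg less_imp_le ratio_pos) (auto dest: E_verts)

lemma load_singleton: "load v {u} = (if (v, u) \<in> E then ratio v u else 0)"
proof -
  have "E `` {v} \<inter> {u} = (if (v, u) \<in> E then {u} else {})" by auto
  then show ?thesis by (simp add: load_def)
qed

text \<open>A connected set hanging off \<open>v\<close> loads \<open>v\<close> at least as much as a path of the same order: if it
  is connected by itself, one passes to a neighbour of \<open>v\<close>, whose inequality in \<open>super\<close> amounts to
  one step of the recursion for \<open>h\<close>; otherwise it splits into two parts and \<open>h\<close> is subadditive.\<close>

lemma load_ge_path: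
  assumes "v \<in> V" "R \<subseteq> V" "v \<notin> R" "card R \<le> P" "set_connected E (insert v R)"
  shows "h (card R) < load v R \<or> h (card R) = load v R \<and> path_from v R"
  using assms
proof (induction "card R" arbitrary: v R rule: less_induct)
  case less
  have finR: "finite R" using less.prems fin_V finite_subset by blast
  show ?case
  proof (cases "R = {}")
    case True
    then have "path_from v R"
      unfolding path_from_def using E_irrefl
      by (auto intro!: exI[of _ "\<lambda>_. v"] simp: bij_betw_def)
    then show ?thesis using True by (simp add: load_def)
  next
    case False
    then obtain c where c: "c \<in> R" "(v, c) \<in> E"
      using set_connectedD[OF less.prems(5), of "{v}"] less.prems(3) by auto
    have cV: "c \<in> V" using c less.prems by auto
    show ?thesis
    proof (cases "set_connected E R")
      case True
      define R' where "R' = R - {c}"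
      define r where "r = card R'"
      have R: "R = insert c R'" "c \<notin> R'" using c by (auto simp: R'_def)
      have card: "card R = Suc r" 
        unfolding r_def R'_def by (simp only: card_Suc_Diff1[OF finR c(1)])
      have IH: "h r < load c R' \<or> h r = load c R' \<and> path_from c R'"
        unfolding r_def
        by (rule less.hyps) (use R card less.prems True cV in \<open>auto simp: r_def\<close>)
      \<comment> \<open>\<open>y\<close> is \<open>ratio c v\<close> without its summand
        \<open>\<alpha>\<close>. The inequality at \<open>c\<close> gives
        \<open>y \<le> l - \<alpha> - h r\<close>, and since \<open>ratio v c\<close> involves the
        reciprocal quotient, an upper bound on \<open>y\<close> is a lower bound on it.\<close>
      define y where "y = (1 - \<alpha>) * (x v / x c)"
      have y: "y > 0" using x_pos less.prems cV \<alpha>1 by (simp add: y_def)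
      have "load c (insert v R') = ratio c v + load c R'"
        using load_Un[of "{v}" R' c] load_singleton[of c v] less.prems(3) R E_sym[OF c(2)] by auto
      then have lc: "load c (insert v R') = \<alpha> + y + load c R'"
        by (simp add: ratio_def y_def)
      have y_le: "y \<le> l - \<alpha> - h r"
        using load_le(1)[OF cV, of "insert v R'"] lc IH by auto
      have ratio_vc: "ratio v c = \<alpha> + (1 - \<alpha>)\<^sup>2 / y"
        using x_pos[OF less.prems(1)] x_pos[OF cV] \<alpha>1
        by (simp add: ratio_def y_def power2_eq_square)
      have hS: "h (card R) = \<alpha> + (1 - \<alpha>)\<^sup>2 / (l - \<alpha> - h r)" by (simp add: card)
      have h_le: "h (card R) \<le> ratio v c"
        unfolding hS ratio_vc using y y_le by (intro add_left_mono divide_left_mono) auto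
      have lv: "load v R = ratio v c + load v R'"
        using load_Un[of "{c}" R' v] load_singleton[of v c] R c by auto
      show ?thesis
      \<comment> \<open>Equality is possible only if the bound on \<open>y\<close> is tight and
        \<open>c\<close> is the only neighbour of \<open>v\<close> in \<open>R\<close>.\<close>
      proof (cases "y = l - \<alpha> - h r \<and> E `` {v} \<inter> R' = {}")
        case True
        have "load v R' = 0" using True by (simp add: load_def)
        then have "h (card R) = load v R" using True by (simp add: lv hS ratio_vc)
        \<comment> \<open>The inequality at \<open>c\<close> is now tight, so \<open>c\<close> has
          no neighbours outside \<open>insert v R'\<close>, and the induction hypothesis holds with
          equality.\<close>
        moreover have "load c (insert v R') \<ge> l"
          using lc True IH by auto
        then have "E `` {c} \<subseteq> insert v R'" "h r = load c R'" "path_from c R'"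
          using load_le[OF cV, of "insert v R'"] IH lc True by fastforce+
        then obtain f where f: "\<forall>u\<in>R'. E `` {u} \<subseteq> R" "bij_betw f {0..r} R" "f r = c"
            "\<forall>i\<le>r. \<forall>j\<le>r. (f i, f j) \<in> E \<longleftrightarrow> j = Suc i \<or> i = Suc j"
          unfolding path_from_def r_def[symmetric] R(1)[symmetric] by blast
        define f' where "f' = f(Suc r := v)"
        have "bij_betw f' {0..Suc r} (insert v R)"
        proof -
          have "bij_betw f' {0..r} R"
            using f(2) by (rule bij_betw_cong[THEN iffD1, rotated]) (simp add: f'_def)
          then have "bij_betw f' ({0..r} \<union> {Suc r}) (R \<union> {v})"
            using less.prems(3) by (intro bij_betw_combine) (auto simp: f'_def)
          then show ?thesis by (simp add: atLeast0AtMost atMost_Suc)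
        qed
        moreover have "(f' i, f' j) \<in> E \<longleftrightarrow> j = Suc i \<or> i = Suc j" if "i \<le> Suc r" "j \<le> Suc r" for i j
        proof -
          have nv: "(v, f i) \<in> E \<longleftrightarrow> i = r" "(f i, v) \<in> E \<longleftrightarrow> i = r" if "i \<le> r" for i
          proof -
            have "f i \<in> R" using f(2) that by (auto simp: bij_betw_def)
            moreover have "f i = c \<longleftrightarrow> i = r"
              using f(2,3) that by (auto simp: bij_betw_def inj_on_def)
            ultimately show "(v, f i) \<in> E \<longleftrightarrow> i = r"
              using True c by (auto simp: R'_def)
            then show "(f i, v) \<in> E \<longleftrightarrow> i = r" using E_sym by blast
          qed
          show ?thesis
            using that f(4) nv E_irrefl by (auto simp: f'_def le_Suc_eq)
        qed
        moreover have "f' (Suc r) = v" by (simp add: f'_def)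
        moreover have "\<forall>u\<in>R. E `` {u} \<subseteq> insert v R"
          using f(1) \<open>E `` {c} \<subseteq> insert v R'\<close> R by auto
        ultimately have "path_from v R"
          unfolding path_from_def card by blast
        then show ?thesis using \<open>h (card R) = load v R\<close> by blast
      next
        case False
        have "h (card R) < load v R"
        proof (cases "y = l - \<alpha> - h r")
          case True
          then obtain u where u: "u \<in> E `` {v} \<inter> R'" using False by blast
          have "load v R' > 0"
            unfolding load_def
            by (rule sum_pos2[of _ u])
              (use u fin_E ratio_pos less.prems(1) E_verts in \<open>auto intro: less_imp_le\<close>)
          then show ?thesis using h_le lv by simp
        next
          case neq: False
          then have "(1 - \<alpha>)\<^sup>2 / (l - \<alpha> - h r) < (1 - \<alpha>)\<^sup>2 / y"
            using y y_le \<alpha>1 by (intro divide_strict_left_mono) auto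
          then show ?thesis
            using lv load_nonneg[OF less.prems(1), of R'] unfolding hS ratio_vc by simp
        qed
        then show ?thesis by blast
      qed
    next
      case False
      then obtain R1 where R1: "R1 \<subset> R" "R1 \<noteq> {}" "\<And>a b. a \<in> R1 \<Longrightarrow> b \<in> R - R1 \<Longrightarrow> (a, b) \<notin> E"
        unfolding set_connected_def by blast
      define R2 where "R2 = R - R1"
      have R: "R = R1 \<union> R2" "R1 \<inter> R2 = {}" "R2 \<subset> R" "R2 \<noteq> {}" using R1 by (auto simp: R2_def)
      have fin: "finite R1" "finite R2" using finR R by (metis finite_Un)+
      have card: "card R = card R1 + card R2" "card R1 \<ge> 1" "card R2 \<ge> 1"
        using fin R R1 by (auto simp: card_Un_disjoint Suc_le_eq card_gt_0_iff)
      have "set_connected E (insert v R1)"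
        by (rule set_connected_split[OF sym_E less.prems(5,3)]) (use R1 in auto)
      then have "h (card R1) \<le> load v R1"
        using less.hyps[of R1 v] card less.prems R1 by fastforce
      moreover have "set_connected E (insert v R2)"
      proof (rule set_connected_split[OF sym_E less.prems(5,3)])
        show "(a, b) \<notin> E" if "a \<in> R2" "b \<in> R - R2" for a b
          using R1(3)[of b a] E_sym[of a b] that R by auto
      qed (use R in auto)
      then have "h (card R2) \<le> load v R2"
        using less.hyps[of R2 v] card less.prems R by fastforce
      moreover have "h (card R) < h (card R1) + h (card R2)"
        unfolding card(1) using card less.prems by (intro h_subadd) auto
      moreover have "load v R = load v R1 + load v R2"
        unfolding R(1) using R(2) by (rule load_Un)
      ultimately show ?thesis by simp
    qed
  qed
qed

end

section \<open>Parts hanging off a clique\<close>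

text \<open>\<open>g\<close> sends each vertex to the clique vertex it hangs off. Edges between
  different parts are not excluded beforehand. For \<open>q = 2\<close>, \<open>g_q2\<close> stands
  in for subadditivity of \<open>excess\<close>.\<close>

locale clique_supersolution =
  path_supersolution \<alpha> l P V E x + clique_path_weights \<alpha> l P q
  for \<alpha> l :: real and P :: nat and V :: "'a set" and E :: "'a rel" and x :: "'a \<Rightarrow> real" and q :: nat +
  fixes K :: "'a set" and g :: "'a \<Rightarrow> 'a"
  assumes K_V: "K \<subseteq> V" and clique: "\<And>u v. u \<in> K \<Longrightarrow> v \<in> K \<Longrightarrow> u \<noteq> v \<Longrightarrow> (u, v) \<in> E"
    and card_K: "card K = q" and card_V: "card V = P + q"
    and g_K: "\<And>i. i \<in> K \<Longrightarrow> g i = i" and g_V: "\<And>v. v \<in> V \<Longrightarrow> g v \<in> K"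
    and g_connected: "\<And>i. i \<in> K \<Longrightarrow> set_connected E {v \<in> V. g v = i}"
    and g_q2: "q = 2 \<Longrightarrow> \<exists>i\<in>K. \<forall>v\<in>V - K. g v = i"
begin

definition part :: "'a \<Rightarrow> 'a set" where
  "part i = {v \<in> V - K. g v = i}"

definition total :: real where
  "total = (\<Sum>i\<in>K. x i)"

lemma fin_K: "finite K"
  using K_V fin_V finite_subset by blast

lemma K_nonempty: "K \<noteq> {}"
  using card_K q2 by auto

lemma total_pos: "total > 0"
  unfolding total_def using fin_K K_nonempty K_V x_pos by (intro sum_pos) auto

lemma card_V_K: "card (V - K) = P"
  using card_Diff_subset[OF fin_K K_V] card_V card_K by simp

lemma part_union: "V - K = (\<Union>i\<in>K. part i)"
  using g_V by (auto simp: part_def)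

lemma sum_card_part: "(\<Sum>i\<in>K. card (part i)) = P"
proof -
  have "card (\<Union>i\<in>K. part i) = (\<Sum>i\<in>K. card (part i))"
    using fin_K fin_V by (intro card_UN_disjoint) (auto simp: part_def)
  then show ?thesis using part_union card_V_K by simp
qed

lemma card_part_le: "i \<in> K \<Longrightarrow> card (part i) \<le> P"
  using sum_card_part member_le_sum[of i K "\<lambda>i. card (part i)"] fin_K by simp

lemma load_part:
  assumes "i \<in> K"
  shows "h (card (part i)) < load i (part i) \<or>
    h (card (part i)) = load i (part i) \<and> path_from i (part i)"
proof (rule load_ge_path)
  have "insert i (part i) = {v \<in> V. g v = i}"
    using assms K_V g_K by (auto simp: part_def)
  then show "set_connected E (insert i (part i))"
    using g_connected[OF assms] by simp
qed (use assms K_V card_part_le in \<open>auto simp: part_def\<close>)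

lemma load_clique:
  assumes "i \<in> K"
  shows "load i (K \<union> part i) = \<alpha> * q - 1 + (1 - \<alpha>) * (total / x i) + load i (part i)"
proof -
  have "E `` {i} \<inter> K = K - {i}" using clique[of i] assms E_irrefl by auto
  then have "load i K = (\<Sum>u\<in>K - {i}. \<alpha> + (1 - \<alpha>) * (x u / x i))"
    by (simp add: load_def ratio_def)
  also have "\<dots> = (q - 1) * \<alpha> + (1 - \<alpha>) * ((\<Sum>u\<in>K - {i}. x u) / x i)"
    using assms card_K fin_K by (simp add: sum.distrib sum_distrib_left sum_divide_distrib)
  also have "(\<Sum>u\<in>K - {i}. x u) = total - x i"
    using assms fin_K by (simp add: total_def sum_diff1)
  also have "(1 - \<alpha>) * ((total - x i) / x i) = (1 - \<alpha>) * (total / x i) - (1 - \<alpha>)"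
    using x_pos[of i] assms K_V by (auto simp: diff_divide_distrib right_diff_distrib)
  finally have "load i K = \<alpha> * q - 1 + (1 - \<alpha>) * (total / x i)"
    using q2 by (simp add: of_nat_diff algebra_simps)
  moreover have "load i (K \<union> part i) = load i K + load i (part i)"
    by (rule load_Un) (auto simp: part_def)
  ultimately show ?thesis by simp
qed

lemma clique_ratio_bound:
  assumes "i \<in> K"
  shows "(1 - \<alpha>) * (total / x i) \<le> L - load i (part i)"
    and "\<not> E `` {i} \<subseteq> K \<union> part i \<Longrightarrow> (1 - \<alpha>) * (total / x i) < L - load i (part i)"
  using load_le[of i "K \<union> part i"] load_clique[OF assms] assms K_V by auto

text \<open>These bounds are meant to be summed over \<open>K\<close>, where the shares
  \<open>x i / total\<close> add up to 1; strictness records any deviation from a kite at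
  \<open>i\<close>.\<close>

lemma clique_entry_bound:
  assumes "i \<in> K"
  shows "(1 - \<alpha>) / L * (1 + excess (card (part i))) \<le> x i / total"
    and "\<not> (E `` {i} \<subseteq> K \<union> part i \<and> path_from i (part i)) \<Longrightarrow>
      (1 - \<alpha>) / L * (1 + excess (card (part i))) < x i / total"
proof -
  let ?h = "h (card (part i))"
  have xi: "x i > 0" using assms K_V x_pos by auto
  have Lh: "L - ?h > 0" using h_lt_L card_part_le assms by simp
  have le: "(1 - \<alpha>) * (total / x i) \<le> L - ?h"
    using clique_ratio_bound(1)[OF assms] load_part[OF assms] by auto
  have "(1 - \<alpha>) / (L - ?h) \<le> x i / total"
    using le Lh xi total_pos by (simp add: field_simps)
  then show "(1 - \<alpha>) / L * (1 + excess (card (part i))) \<le> x i / total"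
    using clique_excess card_part_le assms by simp
  assume "\<not> (E `` {i} \<subseteq> K \<union> part i \<and> path_from i (part i))"
  then have lt: "(1 - \<alpha>) * (total / x i) < L - ?h"
    using clique_ratio_bound[OF assms] load_part[OF assms] by fastforce
  have "(1 - \<alpha>) / (L - ?h) < x i / total"
    using lt Lh xi total_pos by (simp add: field_simps)
  then show "(1 - \<alpha>) / L * (1 + excess (card (part i))) < x i / total"
    using clique_excess card_part_le assms by simp
qed

lemma excess_0: "excess 0 = 0"
  by (simp add: excess_def)

text \<open>The entry bounds sum to at most 1, and by \<open>clique_eq\<close> the sum would be
  exactly 1 with all of \<open>V - K\<close> in one part. For \<open>3 \<le> q\<close> strict
  subadditivity of \<open>excess\<close> thus leaves only one nonempty part at most, and then every
  bound is tight.\<close>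

lemma extremal_structure:
  obtains i where "i \<in> K" "part i = V - K" "path_from i (V - K)" "\<And>j. j \<in> K \<Longrightarrow> E `` {j} \<subseteq> K \<union> part j"
proof -
  let ?p = "\<lambda>i. card (part i)"
  have "(1 - \<alpha>) / (L - h P) + (q - 1) * (1 - \<alpha>) / L = (1 - \<alpha>) / L * (q + excess P)"
  proof -
    have "A * (1 + e) + real (q - 1) * A = A * (q + e)" for A e :: real
      using q2 by (simp add: of_nat_diff algebra_simps)
    from this[of "(1 - \<alpha>) / L" "excess P"] show ?thesis
      using clique_excess[of P] by simp
  qed
  then have eq1: "(1 - \<alpha>) / L * (q + excess P) = 1"
    using clique_eq by (rule trans[OF sym])
  have lhs: "(\<Sum>i\<in>K. (1 - \<alpha>) / L * (1 + excess (?p i))) = (1 - \<alpha>) / L * (q + (\<Sum>i\<in>K. excess (?p i)))"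
    by (subst sum_distrib_left[symmetric]) (simp add: card_K sum.distrib)
  have rhs: "(\<Sum>i\<in>K. x i / total) = 1"
    using total_pos by (simp add: total_def sum_divide_distrib[symmetric])
  have coef: "(1 - \<alpha>) / L > 0" using \<alpha>1 L_pos by simp
  have "(\<Sum>i\<in>K. (1 - \<alpha>) / L * (1 + excess (?p i))) \<le> (\<Sum>i\<in>K. x i / total)"
    by (intro sum_mono clique_entry_bound)
  then have le: "(1 - \<alpha>) / L * (q + (\<Sum>i\<in>K. excess (?p i))) \<le> (1 - \<alpha>) / L * (q + excess P)"
    unfolding lhs rhs eq1 .
  have "\<exists>i\<in>K. ?p i = P"
  proof (cases "q = 2")
    case True
    then obtain i where i: "i \<in> K" "\<forall>v\<in>V - K. g v = i" using g_q2 by blast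
    then have "part i = V - K" by (auto simp: part_def)
    then have "?p i = P" using card_V_K by simp
    then show ?thesis using i(1) by blast
  next
    case False
    then have "3 \<le> q" using q2 by simp
    then have "(\<exists>i\<in>K. ?p i = sum ?p K) \<or> excess (sum ?p K) < (\<Sum>i\<in>K. excess (?p i))"
      using sum_strict_subadditive[OF fin_K K_nonempty, of excess P ?p]
        excess_0 excess_strict_subadditive sum_card_part by auto
    moreover have "(\<Sum>i\<in>K. excess (?p i)) \<le> excess P"
      using le unfolding mult_le_cancel_left_pos[OF coef] by simp
    ultimately show ?thesis using sum_card_part by auto
  qed
  then obtain i where i: "i \<in> K" "?p i = P" by blast
  have part_i: "part i = V - K"
    using i card_V_K fin_V by (intro card_subset_eq) (auto simp: part_def)
  have "?p j = 0" if "j \<in> K - {i}" for j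
  proof -
    have "part j = {}" using part_i that by (auto simp: part_def)
    then show ?thesis by simp
  qed
  then have excess_sum: "(\<Sum>j\<in>K. excess (?p j)) = excess P"
    using i fin_K excess_0 by (subst sum.remove[of _ i]) auto
  have sum_eq: "(\<Sum>j\<in>K. (1 - \<alpha>) / L * (1 + excess (?p j))) = (\<Sum>j\<in>K. x j / total)"
    unfolding lhs rhs excess_sum by (rule eq1)
  have tight: "E `` {j} \<subseteq> K \<union> part j \<and> path_from j (part j)" if "j \<in> K" for j
  proof (rule ccontr)
    assume "\<not> ?thesis"
    then have "(\<Sum>j\<in>K. (1 - \<alpha>) / L * (1 + excess (?p j))) < (\<Sum>j\<in>K. x j / total)"
      using that clique_entry_bound fin_K by (intro sum_strict_mono_ex1) auto
    then show False using sum_eq by simp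
  qed
  show ?thesis
  proof (rule that[OF i(1) part_i])
    show "path_from i (V - K)" using tight[OF i(1)] part_i by simp
  qed (use tight in blast)
qed

text \<open>The attachment vertex \<open>i\<close> ends the path and belongs to the clique, hence
  gets the index \<open>P\<close>; the other clique vertices may be numbered arbitrarily.\<close>

lemma kite_enumeration:
  obtains f where "bij_betw f {0..<P + q} V"
    "\<And>a b. a < P + q \<Longrightarrow> b < P + q \<Longrightarrow> (f a, f b) \<in> E \<longleftrightarrow> (a, b) \<in> parcs (PK P q)"
proof -
  obtain i where i: "i \<in> K" "part i = V - K" "path_from i (V - K)"
    and nb: "\<And>j. j \<in> K \<Longrightarrow> E `` {j} \<subseteq> K \<union> part j"
    by (rule extremal_structure) blast
  obtain f1 where f1: "bij_betw f1 {0..P} (insert i (V - K))" "f1 P = i"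
      "\<And>a b. a \<le> P \<Longrightarrow> b \<le> P \<Longrightarrow> (f1 a, f1 b) \<in> E \<longleftrightarrow> b = Suc a \<or> a = Suc b"
    and nR: "\<forall>u\<in>V - K. E `` {u} \<subseteq> insert i (V - K)"
    using i(3) unfolding path_from_def card_V_K by blast
  have "card {Suc P..<P + q} = card (K - {i})"
    using i card_K fin_K by simp
  then obtain f2 where f2: "bij_betw f2 {Suc P..<P + q} (K - {i})"
    using finite_same_card_bij[of "{Suc P..<P + q}" "K - {i}"] fin_K by auto
  define f where "f a = (if a \<le> P then f1 a else f2 a)" for a
  have "bij_betw f ({0..P} \<union> {Suc P..<P + q}) (insert i (V - K) \<union> (K - {i}))"
  proof (rule bij_betw_combine)
    show "bij_betw f {0..P} (insert i (V - K))"
      using f1(1) by (rule bij_betw_cong[THEN iffD1, rotated]) (simp add: f_def)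
    show "bij_betw f {Suc P..<P + q} (K - {i})"
      using f2 by (rule bij_betw_cong[THEN iffD1, rotated]) (simp add: f_def)
  qed auto
  moreover have "{0..P} \<union> {Suc P..<P + q} = {0..<P + q}" using q2 by auto
  moreover have "insert i (V - K) \<union> (K - {i}) = V" using i K_V by auto
  ultimately have bij: "bij_betw f {0..<P + q} V" by simp
  have f1_lt: "f1 a \<in> V - K" if "a < P" for a
  proof -
    have "f1 a \<in> insert i (V - K)" using f1(1) that by (auto simp: bij_betw_def)
    moreover have "f1 a \<noteq> i"
      using f1(1,2) that inj_onD[of f1 "{0..P}" a P] by (auto simp: bij_betw_def)
    ultimately show ?thesis by auto
  qed
  have f2_in: "f2 a \<in> K - {i}" if "P < a" "a < P + q" for a
    using f2 that by (auto simp: bij_betw_def)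
  have mixed: "(f1 a, f2 b) \<in> E \<longleftrightarrow> a = P" "(f2 b, f1 a) \<in> E \<longleftrightarrow> a = P"
    if "a \<le> P" "P < b" "b < P + q" for a b
  proof -
    show "(f1 a, f2 b) \<in> E \<longleftrightarrow> a = P"
    proof (cases "a = P")
      case True
      then show ?thesis using f1(2) f2_in[OF that(2,3)] i clique by auto
    next
      case False
      then show ?thesis using nR f1_lt[of a] f2_in[OF that(2,3)] that by auto
    qed
    then show "(f2 b, f1 a) \<in> E \<longleftrightarrow> a = P" using E_sym by blast
  qed
  have both: "(f2 a, f2 b) \<in> E \<longleftrightarrow> a \<noteq> b" if "P < a" "a < P + q" "P < b" "b < P + q" for a b
  proof -
    have "f2 a = f2 b \<longleftrightarrow> a = b" using f2 that by (auto simp: bij_betw_def inj_on_def)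
    then show ?thesis
      using clique[of "f2 a" "f2 b"] f2_in that E_irrefl by auto
  qed
  have "(f a, f b) \<in> E \<longleftrightarrow> (a, b) \<in> parcs (PK P q)" if ab: "a < P + q" "b < P + q" for a b
  proof -
    consider "a \<le> P" "b \<le> P" | "a \<le> P" "P < b" | "P < a" "b \<le> P" | "P < a" "P < b" by linarith
    then show ?thesis
    proof cases
      case 1
      then show ?thesis using f1(3) q2 by (auto simp: f_def PK_def)
    next
      case 2
      then show ?thesis using mixed(1)[of a b] ab by (auto simp: f_def PK_def)
    next
      case 3
      then show ?thesis using mixed(2)[of b a] ab by (auto simp: f_def PK_def)
    next
      case 4
      then show ?thesis using both[of a b] ab by (auto simp: f_def PK_def)
    qed
  qed
  then show ?thesis using that[of f] bij by blast
qed

end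

section \<open>Kites\<close>

text \<open>Eliminating the entries of the Perron vector from the free end of the path produces the
  recursion for \<open>h\<close>, and positivity keeps its denominators positive. The clique entries
  are proportional to \<open>1 / (L - h P)\<close> once and to \<open>1 / L\<close> otherwise;
  dividing by their sum gives \<open>clique_eq\<close>.\<close>

lemma PK_clique_path_weights:
  assumes \<alpha>: "0 \<le> \<alpha>" "\<alpha> < 1" and q: "2 \<le> q"
  shows "clique_path_weights \<alpha> (rho \<alpha> (PK P q)) P q"
proof -
  interpret pair_graph "PK P q" using pair_graph_PK q by simp
  define l where "l = rho \<alpha> (PK P q)"
  define \<beta> where "\<beta> = 1 - \<alpha>"
  define C where "C = {P..<P + q}"
  have V: "pverts (PK P q) = {0..<P + q}" by (auto simp: PK_def)
  have conn: "set_connected (parcs (PK P q)) (pverts (PK P q))"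
    unfolding V by (rule set_connected_atLeastLessThan) (auto simp: PK_def)
  have ne: "pverts (PK P q) \<noteq> {}" using q by (simp add: V)
  obtain x where x: "\<And>v. v \<in> pverts (PK P q) \<Longrightarrow> x v > 0"
    "\<And>v. v \<in> pverts (PK P q) \<Longrightarrow>
      (\<Sum>u\<in>neighbours (PK P q) v. \<alpha> * x v + (1 - \<alpha>) * x u) = rho \<alpha> (PK P q) * x v"
    by (rule rho_perron_vector[OF \<alpha> conn ne]) blast
  have x_pos: "x v > 0" if "v < P + q" for v
    using x(1)[of v] that by (simp add: V)
  have eig: "(\<Sum>u\<in>neighbours (PK P q) v. \<alpha> * x v + \<beta> * x u) = l * x v" if "v < P + q" for v
    using x(2)[of v] that by (simp add: V l_def \<beta>_def)
  have \<beta>: "\<beta> > 0" using \<alpha> by (simp add: \<beta>_def)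
  let ?h = "path_weight \<alpha> l"
  have step: "?h (Suc n) * x (Suc n) = \<alpha> * x (Suc n) + \<beta> * x n"
    if "(l - \<alpha> - ?h n) * x n = \<beta> * x (Suc n)" "?h n < l - \<alpha>" "n < P" for n
  proof -
    have "\<beta>\<^sup>2 / (l - \<alpha> - ?h n) * x (Suc n) = \<beta> * x n"
      using that by (simp add: field_simps power2_eq_square)
    then show ?thesis by (simp add: \<beta>_def[symmetric] distrib_right)
  qed
  have path: "(l - \<alpha> - ?h n) * x n = \<beta> * x (Suc n) \<and> ?h n < l - \<alpha>" if "n < P" for n
    using that
  proof (induction n)
    case 0
    then have "neighbours (PK P q) 0 = {1}" using q by (auto simp: PK_def)
    then have "(l - \<alpha>) * x 0 = \<beta> * x 1" using eig[of 0] q by (simp add: algebra_simps)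
    moreover have "\<beta> * x 1 > 0" "x 0 > 0" using \<beta> x_pos q by auto
    ultimately show ?case by (metis One_nat_def diff_zero path_weight.simps(1) zero_less_mult_pos2)
  next
    case (Suc n)
    then have "neighbours (PK P q) (Suc n) = {n, Suc (Suc n)}" using q by (auto simp: PK_def)
    then have "l * x (Suc n) = 2 * \<alpha> * x (Suc n) + \<beta> * x n + \<beta> * x (Suc (Suc n))"
      using eig[of "Suc n"] Suc.prems by simp
    then have eq: "(l - \<alpha> - ?h (Suc n)) * x (Suc n) = \<beta> * x (Suc (Suc n))"
      using step[of n] Suc by (simp add: left_diff_distrib del: path_weight.simps)
    moreover have "\<beta> * x (Suc (Suc n)) > 0" "x (Suc n) > 0" using \<beta> x_pos Suc.prems q by auto
    ultimately have "(l - \<alpha> - ?h (Suc n)) * x (Suc n) > 0" by simp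
    then have "?h (Suc n) < l - \<alpha>"
      using \<open>x (Suc n) > 0\<close> by (simp add: zero_less_mult_iff del: path_weight.simps)
    then show ?case using eq by blast
  qed
  define S where "S = (\<Sum>v\<in>C. x v)"
  have S_pos: "S > 0" unfolding S_def C_def using q x_pos by (intro sum_pos) auto
  have clique_sum: "(\<Sum>u\<in>C - {v}. \<alpha> * x v + \<beta> * x u) = (\<alpha> * q - 1) * x v + \<beta> * S" if "v \<in> C" for v
  proof -
    have "(\<Sum>u\<in>C - {v}. \<alpha> * x v + \<beta> * x u) = real (q - 1) * (\<alpha> * x v) + \<beta> * (\<Sum>u\<in>C - {v}. x u)"
      using that by (simp add: sum.distrib sum_distrib_left C_def)
    also have "(\<Sum>u\<in>C - {v}. x u) = S - x v"
      using that by (simp add: S_def sum_diff1 C_def)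
    finally show ?thesis using q by (simp add: of_nat_diff \<beta>_def algebra_simps)
  qed
  let ?L = "l - \<alpha> * q + 1"
  have clique: "?L * x v = \<beta> * S" if v: "v \<in> C - {P}" for v
  proof -
    have "neighbours (PK P q) v = C - {v}" using v by (auto simp: PK_def C_def)
    then show ?thesis using eig[of v] clique_sum[of v] v by (auto simp: C_def algebra_simps)
  qed
  \<comment> \<open>For \<open>P = 0\<close> there is no path edge at the joint, in accordance with
    \<open>h 0 = 0\<close>.\<close>
  have joint: "(?L - ?h P) * x P = \<beta> * S"
  proof (cases P)
    case 0
    then have "neighbours (PK P q) P = C - {P}" by (auto simp: PK_def C_def)
    then show ?thesis using eig[of P] clique_sum[of P] q 0 by (auto simp: C_def algebra_simps)
  next
    case (Suc m)
    then have "neighbours (PK P q) P = insert m (C - {P})" using q by (auto simp: PK_def C_def)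
    moreover have "m \<notin> C - {P}" "finite (C - {P})" using Suc by (auto simp: C_def)
    ultimately have "l * x P = \<alpha> * x P + \<beta> * x m + (\<Sum>u\<in>C - {P}. \<alpha> * x P + \<beta> * x u)"
      using eig[of P] q by (simp add: algebra_simps)
    moreover have "P \<in> C" using q by (simp add: C_def)
    ultimately have "l * x P = \<alpha> * x P + \<beta> * x m + ((\<alpha> * q - 1) * x P + \<beta> * S)"
      by (simp only: clique_sum)
    moreover have "?h P * x P = \<alpha> * x P + \<beta> * x m"
      using step[of m] path[of m] Suc by simp
    ultimately show ?thesis by (simp add: algebra_simps)
  qed
  have L_pos: "?L > 0"
  proof -
    have "Suc P \<in> C - {P}" using q by (auto simp: C_def)
    then have "?L * x (Suc P) = \<beta> * S" by (rule clique)
    moreover have "\<beta> * S > 0" "x (Suc P) > 0" using \<beta> S_pos x_pos q by auto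
    ultimately show ?thesis by (metis zero_less_mult_pos2)
  qed
  have Lh_pos: "?L - ?h P > 0"
  proof -
    have "\<beta> * S > 0" "x P > 0" using \<beta> S_pos x_pos q by auto
    then show ?thesis using joint by (metis zero_less_mult_pos2)
  qed
  have "\<beta> / (?L - ?h P) = x P / S"
    using joint Lh_pos S_pos by (simp add: field_simps)
  moreover have "x v = \<beta> * S / ?L" if "v \<in> C - {P}" for v
    using clique[OF that] L_pos by (simp add: field_simps)
  then have "(\<Sum>v\<in>C - {P}. x v) = (q - 1) * (\<beta> * S / ?L)"
    using q by (simp add: C_def)
  then have "S = x P + (q - 1) * (\<beta> * S / ?L)"
    using q unfolding S_def by (subst sum.remove[of _ P]) (auto simp: C_def)
  then have "S / S = x P / S + (q - 1) * (\<beta> * S / ?L) / S"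
    by (metis add_divide_distrib)
  then have "1 = x P / S + (q - 1) * \<beta> / ?L" using S_pos by simp
  ultimately have "\<beta> / (?L - ?h P) + (q - 1) * \<beta> / ?L = 1" by simp
  then show ?thesis
    unfolding l_def[symmetric] using path Lh_pos \<alpha> q
    by unfold_locales (simp_all add: \<beta>_def)
qed

section \<open>Maximum cliques and graph isomorphisms\<close>

lemma clique_number_clique:
  assumes "finite (pverts G)"
  obtains K where "is_clique G K" "card K = clique_number G"
proof -
  have "finite {S. is_clique G S}"
    using assms by (rule finite_subset[of _ "Pow (pverts G)", rotated, OF finite_Pow_iff[THEN iffD2]])
      (auto simp: is_clique_def)
  moreover have "{} \<in> {S. is_clique G S}" by (simp add: is_clique_def)
  ultimately have "Max (card ` {S. is_clique G S}) \<in> card ` {S. is_clique G S}"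
    by (intro Max_in) auto
  then show ?thesis using that by (auto simp: clique_number_def)
qed

lemma (in pair_graph) digraph_isoI:
  fixes H :: "'b pair_pre_digraph"
  assumes bij: "bij_betw f (pverts H) (pverts G)" and wf: "pair_wf_digraph H"
    and arcs: "\<And>a b. a \<in> pverts H \<Longrightarrow> b \<in> pverts H \<Longrightarrow> (f a, f b) \<in> parcs G \<longleftrightarrow> (a, b) \<in> parcs H"
  shows "digraph_iso (with_proj G) (with_proj H)"
proof -
  interpret H: pair_wf_digraph H by fact
  define g where "g = the_inv_into (pverts H) f"
  have inj: "inj_on f (pverts H)" and im: "f ` pverts H = pverts G"
    using bij by (auto simp: bij_betw_def)
  have fg: "f (g v) = v" "g v \<in> pverts H" if "v \<in> pverts G" for v
    using that inj im by (auto simp: g_def f_the_inv_into_f the_inv_into_into)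
  have gf: "g (f a) = a" if "a \<in> pverts H" for a
    using that inj by (simp add: g_def the_inv_into_f_f)
  \<comment> \<open>The isomorphism leads from \<open>G\<close> to \<open>H\<close>, so it is built
    from the inverse of \<open>f\<close>; arcs are pairs, on which it acts componentwise.\<close>
  define \<phi> where "\<phi> = \<lparr>iso_verts = g, iso_arcs = map_prod g g,
    iso_head = snd :: 'b \<times> 'b \<Rightarrow> 'b, iso_tail = fst :: 'b \<times> 'b \<Rightarrow> 'b\<rparr>"
  have inj_g: "inj_on g (pverts G)" by (rule inj_on_inverseI) (rule fg)
  have "inj_on (map_prod g g) (parcs G)"
    using map_prod_inj_on[OF inj_g inj_g] by (rule inj_on_subset) (auto dest: wellformed')
  then have "digraph_isomorphism \<phi>"
    using inj_g wf_digraph_wp_iff[of G] unfolding digraph_isomorphism_def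
    by (auto simp: \<phi>_def intro: wf_digraph)
  moreover have "g ` pverts G = pverts H"
    using fg gf im by force
  moreover have "map_prod g g ` parcs G = parcs H"
  proof (intro Set.set_eqI iffI)
    fix e assume "e \<in> map_prod g g ` parcs G"
    then obtain u v where uv: "(u, v) \<in> parcs G" "e = (g u, g v)" by auto
    then show "e \<in> parcs H" using arcs[of "g u" "g v"] fg wellformed'[OF uv(1)] by simp
  next
    fix e assume e: "e \<in> parcs H"
    obtain a b where ab: "e = (a, b)" by force
    then have "a \<in> pverts H" "b \<in> pverts H" using e H.wellformed' by auto
    then have "(f a, f b) \<in> parcs G" "e = map_prod g g (f a, f b)"
      using arcs e ab gf by auto
    then show "e \<in> map_prod g g ` parcs G" by blast
  qed
  ultimately show ?thesis
    unfolding digraph_iso_def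
    by (intro exI[of _ \<phi>]) (simp add: app_iso_def \<phi>_def with_proj_def)
qed

text \<open>Corresponding enumerations of the two graphs yield the same matrix, and
  \<open>rho\<close> does not depend on the enumeration.\<close>

lemma (in pair_graph) digraph_iso_rho_eq:
  fixes H :: "'b pair_pre_digraph"
  assumes "digraph_iso (with_proj G) (with_proj H)"
  shows "rho \<alpha> G = rho \<alpha> H"
proof -
  obtain \<phi> where \<phi>: "digraph_isomorphism \<phi>" "with_proj H = app_iso \<phi> (with_proj G)"
    using assms unfolding digraph_iso_def by blast
  define f where "f = iso_verts \<phi>"
  have H: "pverts H = f ` pverts G" "parcs H = iso_arcs \<phi> ` parcs G" "iso_tail \<phi> = fst" "iso_head \<phi> = snd"
    using \<phi>(2) by (simp_all add: with_proj_def app_iso_def f_def)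
  have "iso_arcs \<phi> e = map_prod f f e" if "e \<in> parcs G" for e
    using \<phi>(1) that unfolding digraph_isomorphism_def H(3,4) by (auto simp: f_def prod_eq_iff)
  then have parcs_H: "parcs H = map_prod f f ` parcs G" unfolding H(2) by (rule image_cong[OF refl])
  have inj: "inj_on f (pverts G)" using \<phi>(1) by (simp add: digraph_isomorphism_def f_def)
  have arcs: "(f u, f v) \<in> parcs H \<longleftrightarrow> (u, v) \<in> parcs G" if "u \<in> pverts G" "v \<in> pverts G" for u v
  proof
    assume "(f u, f v) \<in> parcs H"
    then obtain a b where ab: "(a, b) \<in> parcs G" "f u = f a" "f v = f b" unfolding parcs_H by auto
    then show "(u, v) \<in> parcs G"
      using inj_onD[OF inj, of u a] inj_onD[OF inj, of v b] that wellformed'[OF ab(1)] by auto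
  qed (auto simp: parcs_H)
  have deg: "out_degree (with_proj H) (f v) = out_degree (with_proj G) v" if "v \<in> pverts G" for v
  proof -
    have "neighbours H (f v) = f ` neighbours G v"
    proof (intro Set.set_eqI iffI)
      fix w assume w: "w \<in> neighbours H (f v)"
      then obtain a u where u: "(a, u) \<in> parcs G" "w = f u" unfolding parcs_H by auto
      have "(v, u) \<in> parcs G" using arcs[OF that in_arcsD2[OF u(1)]] w u(2) by simp
      then show "w \<in> f ` neighbours G v" using u(2) by blast
    qed (auto simp: parcs_H)
    moreover have "inj_on f (neighbours G v)"
      using inj by (rule inj_on_subset) (auto dest: wellformed')
    ultimately show ?thesis by (simp add: out_degree_neighbours card_image)
  qed
  obtain vs where vs: "distinct vs" "set vs = pverts G"
    using finite_distinct_list[OF pair_finite_verts] by blast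
  have nth: "vs ! i \<in> pverts G" if "i < length vs" for i
    using vs(2) that by auto
  have "A_alpha \<alpha> G vs = A_alpha \<alpha> H (map f vs)"
    unfolding A_alpha_def degree_mat_def adjacency_mat_def
    by (intro eq_matI) (auto simp: deg[OF nth] arcs[OF nth nth])
  moreover have "distinct (map f vs)" "set (map f vs) = pverts H"
    using vs inj H(1) by (auto simp: distinct_map)
  ultimately show ?thesis
    using rho_enumeration[of vs G \<alpha>] rho_enumeration[of "map f vs" H \<alpha>] vs by simp
qed

text \<open>Under \<open>le\<close> the Perron vector of \<open>G\<close> satisfies the inequalities
  \<open>super\<close>, so once a clique and a map \<open>g\<close> are chosen,
  \<open>kite_enumeration\<close> identifies the graph.\<close>

lemma (in pair_graph) kite_of_rho_le:
  assumes \<alpha>: "0 \<le> \<alpha>" "\<alpha> < 1" and conn: "set_connected (parcs G) (pverts G)"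
    and "pverts G \<noteq> {}" and \<omega>: "2 \<le> clique_number G" "card (pverts G) = P + clique_number G"
    and le: "rho \<alpha> G \<le> rho \<alpha> (PK P (clique_number G))"
  shows "digraph_iso (with_proj G) (with_proj (PK P (clique_number G)))"
proof -
  define q where "q = clique_number G"
  define l where "l = rho \<alpha> (PK P q)"
  let ?V = "pverts G" and ?E = "parcs G"
  interpret W: clique_path_weights \<alpha> l P q
    unfolding l_def using \<alpha> \<omega> by (intro PK_clique_path_weights) (simp_all add: q_def)
  obtain x where x: "\<And>v. v \<in> ?V \<Longrightarrow> x v > 0"
    "\<And>v. v \<in> ?V \<Longrightarrow> (\<Sum>u\<in>neighbours G v. \<alpha> * x v + (1 - \<alpha>) * x u) = rho \<alpha> G * x v"
    using rho_perron_vector[OF \<alpha> conn assms(4)] by blast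
  have E: "sym ?E" "?E \<subseteq> ?V \<times> ?V" "irrefl ?E"
    using sym_parcs no_loops' by (auto simp: irrefl_def dest: wellformed')
  text \<open>If \<open>q = 2\<close>, attaching paths to both ends of an edge also gives a path, so that \<open>excess\<close> cannot be
    strictly subadditive; instead, the edge is chosen such that one of its ends is not a cut vertex,
    and everything hangs off the other one.\<close>

  have "\<exists>K g. K \<subseteq> ?V \<and> (\<forall>u\<in>K. \<forall>v\<in>K. u \<noteq> v \<longrightarrow> (u, v) \<in> ?E) \<and> card K = q \<and>
    (\<forall>i\<in>K. g i = i) \<and> (\<forall>v\<in>?V. g v \<in> K) \<and> (\<forall>i\<in>K. set_connected ?E {v \<in> ?V. g v = i}) \<and>
    (q = 2 \<longrightarrow> (\<exists>i\<in>K. \<forall>v\<in>?V - K. g v = i))"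
  proof (cases "q = 2")
    case True
    have "2 \<le> card ?V" using \<omega> by simp
    then obtain r where r: "r \<in> ?V" "set_connected ?E (?V - {r})"
      using set_connected_remove_vertex[OF pair_finite_verts E(1) conn] by blast
    have "card (?V - {r}) \<noteq> 0" using \<open>2 \<le> card ?V\<close> r(1) by simp
    then have "?V \<noteq> {r}" by fastforce
    then obtain s where s: "s \<in> ?V" "s \<noteq> r" "(r, s) \<in> ?E"
      using set_connectedD[OF conn, of "{r}"] r(1) by auto
    define g where "g v = (if v = r then r else s)" for v
    have "{v \<in> ?V. g v = r} = {r}" "{v \<in> ?V. g v = s} = ?V - {r}"
      using r s by (auto simp: g_def)
    then show ?thesis
      using r s True arcs_symmetric
      by (intro exI[of _ "{r, s}"] exI[of _ g]) (auto simp: g_def set_connected_singleton)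
  next
    case False
    obtain K where K: "is_clique G K" "card K = q"
      using clique_number_clique[OF pair_finite_verts] unfolding q_def by blast
    then have "K \<subseteq> ?V" "K \<noteq> {}" using \<omega> by (auto simp: is_clique_def q_def)
    then obtain g where "\<And>i. i \<in> K \<Longrightarrow> g i = i" "\<And>v. v \<in> ?V \<Longrightarrow> g v \<in> K"
      "\<And>i. i \<in> K \<Longrightarrow> set_connected ?E {v \<in> ?V. g v = i}"
      using set_connected_partition[OF pair_finite_verts E(1) conn] by metis
    then show ?thesis
      using K False by (intro exI[of _ K] exI[of _ g]) (auto simp: is_clique_def)
  qed
  then obtain K g where Kg: "K \<subseteq> ?V" "\<forall>u\<in>K. \<forall>v\<in>K. u \<noteq> v \<longrightarrow> (u, v) \<in> ?E" "card K = q"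
    "\<forall>i\<in>K. g i = i" "\<forall>v\<in>?V. g v \<in> K" "\<forall>i\<in>K. set_connected ?E {v \<in> ?V. g v = i}"
    "q = 2 \<longrightarrow> (\<exists>i\<in>K. \<forall>v\<in>?V - K. g v = i)"
    by (elim exE conjE)
  interpret S: clique_supersolution \<alpha> l P ?V ?E x q K g
  proof unfold_locales
    fix v assume v: "v \<in> ?V"
    have "rho \<alpha> G * x v \<le> l * x v"
      using le x(1)[OF v] by (intro mult_right_mono) (simp_all add: l_def q_def)
    then show "(\<Sum>u\<in>neighbours G v. \<alpha> * x v + (1 - \<alpha>) * x u) \<le> l * x v"
      using x(2)[OF v] by simp
  qed (use pair_finite_verts E x(1) W.h_strict_subadditive' Kg \<omega> q_def in auto)
  obtain f where f: "bij_betw f {0..<P + q} ?V"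
    "\<And>a b. a < P + q \<Longrightarrow> b < P + q \<Longrightarrow> (f a, f b) \<in> ?E \<longleftrightarrow> (a, b) \<in> parcs (PK P q)"
    by (rule S.kite_enumeration) blast
  have V: "pverts (PK P q) = {0..<P + q}" by (auto simp: PK_def)
  have "pair_graph (PK P q)" using W.q2 by (intro pair_graph_PK) simp
  then have wf: "pair_wf_digraph (PK P q)"
    by (simp add: pair_graph_def pair_digraph_def pair_fin_digraph_def)
  show ?thesis
    unfolding q_def[symmetric]
    by (rule digraph_isoI[OF _ wf, of f]) (use f V in auto)
qed

theorem theorem5:
  fixes G :: "'a pair_pre_digraph" and \<alpha> :: real and n \<omega> :: nat
  assumes "0 \<le> \<alpha>" and "\<alpha> < 1"
    and "pair_graph G" and "Digraph_Component.connected G"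
    and "card (pverts G) = n"
    and "clique_number G = \<omega>" and "\<omega> \<ge> 2"
  shows "rho \<alpha> G \<ge> rho \<alpha> (PK (n - \<omega>) \<omega>) \<and>
    (rho \<alpha> G = rho \<alpha> (PK (n - \<omega>) \<omega>) \<longleftrightarrow> digraph_iso G (PK (n - \<omega>) \<omega>))"
proof -
  interpret pair_graph G by fact
  note conn = connected_set_connected[OF assms(4)]
  obtain K where "is_clique G K" "card K = \<omega>"
    using clique_number_clique[OF pair_finite_verts] assms(6) by metis
  then have "\<omega> \<le> n"
    using card_mono[OF pair_finite_verts, of K] assms(5) by (simp add: is_clique_def)
  \<comment> \<open>Assuming only \<open>\<le>\<close> also yields the lower bound: a strictly
    smaller radius would give an isomorphism and hence equal radii. The natural subtraction is exact
    by \<open>\<omega> \<le> n\<close>.\<close>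
  then have iso: "digraph_iso G (PK (n - \<omega>) \<omega>)" if "rho \<alpha> G \<le> rho \<alpha> (PK (n - \<omega>) \<omega>)"
    using kite_of_rho_le[OF assms(1,2) conn, of "n - \<omega>"] that assms(5-7) by simp
  have eq: "rho \<alpha> G = rho \<alpha> (PK (n - \<omega>) \<omega>)" if "digraph_iso G (PK (n - \<omega>) \<omega>)"
    using digraph_iso_rho_eq[OF that] .
  show ?thesis
    using iso eq by fastforce
qed

end
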